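(* There is an absolute constant $C>0$ such that the following holds. Suppose that $k,N \in \mathbb{N}$ are such that there is a $k$-colouring of $\{1,\dots,N\}$ with no monochromatic solution to $x-y=z^2$, i.e. no $x,y,z\in\{1,\dots,N\}$ all of the same colour with $x-y=z^2$. Then $N\leq 2^{2^{2^{Ck}}}$.
   Context: A $k$-colouring of a set is a partition of it into at most $k$ colour classes. *)

theory Defs
  imports Complex_Main "HOL-Library.Disjoint_Sets"
begin

text \<open>Colour classes are the blocks of the partition, hence nonempty. Finiteness is required
  explicitly because \<^term>\<open>card\<close> is 0 on infinite sets.\<close>

definition colouring :: "nat \<Rightarrow> 'a set \<Rightarrow> 'a set set \<Rightarrow> bool" where
  "colouring k A P \<longleftrightarrow> partition_on A P \<and> finite P \<and> card P \<le> k"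

text \<open>The equation is read over the integers, since subtraction on \<^typ>\<open>nat\<close> truncates.
  The values \<open>x\<close>, \<open>y\<close>, \<open>z\<close> need not be distinct.\<close>

definition has_mono_solution :: "nat set set \<Rightarrow> bool" where
  "has_mono_solution P \<longleftrightarrow>
     (\<exists>c\<in>P. \<exists>x\<in>c. \<exists>y\<in>c. \<exists>z\<in>c. int x - int y = (int z)\<^sup>2)"

end

theory Submission
  imports Defs "HOL-Analysis.Convex"
begin

text \<open>
  The heart is a quantitative form of Sarkozy's theorem, obtained by density increment without
  Fourier analysis. Let \<open>f\<close> be the balanced function of a set of density \<open>\<beta>\<close> in an interval of length
  \<open>L\<close>. If few squares are differences of the set, then \<open>f\<close> correlates with the average of its
  translates by \<open>(z + h)\<^sup>2\<close>, for \<open>z\<close> up to about \<open>\<surd>L\<close> and \<open>h\<close> in a short list of shifts. A first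
  application of Cauchy--Schwarz makes the translates linear in \<open>z\<close>; a second one turns them into
  \<open>2 u z + 2 v w\<close> with two independent variables. The shifts are chosen such that \<open>gcd u v\<close> is bounded,
  so that these values cover the multiples of \<open>2 gcd u v\<close> evenly on the scale \<open>L\<close> (not just \<open>\<surd>L\<close>).
  Hence the density increases on a progression of bounded difference and length proportional
  to \<open>L\<close>, and iterating costs only a factor exponential in a power of \<open>1/\<beta>\<close>.

  For the colouring, keep one dense set \<open>B\<close> and one \<open>q\<close> such that every active colour contains a
  translate of \<open>q\<^sup>2 B\<close>. If \<open>(d z)\<^sup>2\<close> is a difference of \<open>B\<close>, then \<open>q d z\<close> has none of the active colours;
  as there are many such \<open>z\<close>, a new colour is dense among them, and intersecting \<open>B\<close> with it along
  progressions of differences \<open>d\<^sup>2\<close> and \<open>q d\<close> makes that colour active. Each of the at most \<open>k\<close> steps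
  raises the density to a bounded power and the length to about a fourth root.
\<close>

section \<open>Autocorrelations of periodic functions\<close>

text \<open>Functions on the cyclic group of order \<open>L\<close> are handled as
  \<open>L\<close>-periodic functions on the integers; for such \<open>f\<close> this is the
  unnormalised autocorrelation.\<close>

definition corr :: "nat \<Rightarrow> (int \<Rightarrow> real) \<Rightarrow> int \<Rightarrow> real" where
  "corr L f t = (\<Sum>x\<in>{0..<int L}. f x * f (x + t))"

lemma periodic_mod:
  fixes f :: "int \<Rightarrow> 'a"
  assumes "\<And>x. f (x + int L) = f x"
  shows "f (x mod int L) = f x"
proof -
  have plus: "f (y + int L * int m) = f y" for y m
  proof (induction m)
    case (Suc m)
    have "y + int L * int (Suc m) = (y + int L * int m) + int L"
      by (simp add: algebra_simps)
    with Suc assms show ?case by metis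
  qed simp
  have all: "f (y + int L * k) = f y" for y k
  proof (cases "k \<ge> 0")
    case True
    then show ?thesis using plus[of y "nat k"] by simp
  next
    case False
    then show ?thesis using plus[of "y + int L * k" "nat (-k)"] by (simp add: algebra_simps)
  qed
  show ?thesis using all[of "x mod int L" "x div int L"] by simp
qed

lemma sum_periodic_shift:
  fixes f :: "int \<Rightarrow> 'a::comm_monoid_add"
  assumes per: "\<And>x. f (x + int L) = f x" and "L > 0"
  shows "(\<Sum>x\<in>{0..<int L}. f (x + t)) = (\<Sum>x\<in>{0..<int L}. f x)"
  by (rule sum.reindex_bij_witness[where i = "\<lambda>y. (y - t) mod int L" and j = "\<lambda>x. (x + t) mod int L"])
     (use \<open>L > 0\<close> in \<open>auto simp: mod_simps periodic_mod[of f L, OF per]\<close>)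

lemma sum_shift_mult_shift:
  assumes per: "\<And>x. f (x + int L) = f x" and "L > 0"
  shows "(\<Sum>x\<in>{0..<int L}. f (x + a) * f (x + b)) = corr L f (b - a)"
proof -
  have "f (x + int L) * f (x + int L + (b - a)) = f x * f (x + (b - a))" for x
    using per[of x] per[of "x + (b - a)"] by (simp add: algebra_simps)
  from sum_periodic_shift[of "\<lambda>x. f x * f (x + (b - a))", OF this \<open>L > 0\<close>, of a]
  show ?thesis by (simp add: corr_def algebra_simps)
qed

lemma abs_corr_le:
  assumes "\<And>x. \<bar>f x\<bar> \<le> 1"
  shows "\<bar>corr L f t\<bar> \<le> real L"
proof -
  have "\<bar>corr L f t\<bar> \<le> (\<Sum>x\<in>{0..<int L}. \<bar>f x * f (x + t)\<bar>)"
    unfolding corr_def by (rule sum_abs)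
  also have "\<dots> \<le> (\<Sum>x\<in>{0..<int L}. 1)"
    by (intro sum_mono) (simp add: abs_mult assms mult_le_one)
  finally show ?thesis by simp
qed

text \<open>Cauchy-Schwarz removes the weight \<open>h\<close>, and expanding the remaining square
  gives autocorrelations at differences of the shifts. It is applied once with \<open>h\<close> the
  indicator of a set and once with \<open>h = f\<close>.\<close>

lemma sum_mult_sum_square_le:
  fixes h :: "int \<Rightarrow> real" and t :: "'b \<Rightarrow> int"
  assumes per: "\<And>x. f (x + int L) = f x" and "L > 0"
  shows "(\<Sum>x\<in>{0..<int L}. h x * (\<Sum>p\<in>P. f (x + t p)))\<^sup>2
     \<le> (\<Sum>x\<in>{0..<int L}. (h x)\<^sup>2) * (\<Sum>p\<in>P. \<Sum>p'\<in>P. corr L f (t p' - t p))"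
proof -
  have "(\<Sum>x\<in>{0..<int L}. h x * (\<Sum>p\<in>P. f (x + t p)))\<^sup>2
      \<le> (\<Sum>x\<in>{0..<int L}. (h x)\<^sup>2) * (\<Sum>x\<in>{0..<int L}. (\<Sum>p\<in>P. f (x + t p))\<^sup>2)"
    by (rule Cauchy_Schwarz_ineq_sum)
  also have "(\<Sum>x\<in>{0..<int L}. (\<Sum>p\<in>P. f (x + t p))\<^sup>2)
      = (\<Sum>x\<in>{0..<int L}. \<Sum>p\<in>P. \<Sum>p'\<in>P. f (x + t p) * f (x + t p'))"
    by (simp add: power2_eq_square sum_product)
  also have "\<dots> = (\<Sum>p\<in>P. \<Sum>p'\<in>P. \<Sum>x\<in>{0..<int L}. f (x + t p) * f (x + t p'))"
    by (subst sum.swap, intro sum.cong refl, rule sum.swap)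
  also have "\<dots> = (\<Sum>p\<in>P. \<Sum>p'\<in>P. corr L f (t p' - t p))"
    by (intro sum.cong refl sum_shift_mult_shift[of f L, OF per \<open>L > 0\<close>])
  finally show ?thesis .
qed

section \<open>Averaging over boxes by small Bezout coefficients\<close>

text \<open>Reducing the coefficient of \<open>u\<close> modulo \<open>v\<close> gives
  \<open>0 \<le> a < \<bar>v\<bar>\<close>. Then \<open>v * b\<close> is a difference of two terms
  of size at most \<open>U * \<bar>v\<bar>\<close>, so \<open>b\<close> is small as well.\<close>

lemma bounded_bezout:
  fixes u v s U :: int
  assumes "v \<noteq> 0" "\<bar>u\<bar> \<le> U" "\<bar>v\<bar> \<le> U" "\<bar>gcd u v * s\<bar> \<le> U * \<bar>v\<bar>"
  shows "\<exists>a b. u * a + v * b = gcd u v * s \<and> \<bar>a\<bar> \<le> U \<and> \<bar>b\<bar> \<le> 2 * U"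
proof -
  obtain p r where pr: "p * u + r * v = gcd u v" using bezout_int by blast
  define a where "a = (s * p) mod \<bar>v\<bar>"
  have a: "0 \<le> a" "a < \<bar>v\<bar>" using assms(1) by (auto simp: a_def)
  have "v dvd s * p - a" unfolding a_def
    by (metis abs_dvd_iff dvd_minus_mod)
  then obtain e where e: "s * p - a = v * e" by blast
  have "gcd u v * s - u * a = u * (s * p - a) + v * (r * s)"
    by (simp add: pr[symmetric] algebra_simps)
  also have "\<dots> = v * (u * e + r * s)" unfolding e by (simp add: algebra_simps)
  finally obtain b where b: "gcd u v * s - u * a = v * b" by blast
  have "\<bar>u * a\<bar> \<le> U * \<bar>v\<bar>" using a assms(2) by (simp add: abs_mult mult_mono)
  then have "\<bar>v * b\<bar> \<le> 2 * U * \<bar>v\<bar>"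
    using assms(4) by (simp flip: b)
  then have "\<bar>b\<bar> * \<bar>v\<bar> \<le> 2 * U * \<bar>v\<bar>" by (simp add: abs_mult mult.commute)
  then have "\<bar>b\<bar> \<le> 2 * U" using assms(1) by simp
  moreover have "\<bar>a\<bar> \<le> U" using a assms(3) by linarith
  ultimately show ?thesis using b by (intro exI[of _ a] exI[of _ b]) simp
qed

text \<open>An interval and its translate by \<open>a\<close> differ in at most
  \<open>\<bar>a\<bar>\<close> points on either side.\<close>

lemma abs_sum_shift_diff_le:
  fixes \<phi> :: "int \<Rightarrow> real"
  assumes bnd: "\<And>z. \<bar>\<phi> z\<bar> \<le> b"
  shows "\<bar>(\<Sum>z\<in>{1..int M}. \<phi> (z + a)) - (\<Sum>z\<in>{1..int M}. \<phi> z)\<bar> \<le> 2 * real_of_int \<bar>a\<bar> * b"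
proof -
  have b: "b \<ge> 0" using bnd[of 0] by linarith
  define X Y where "X = {1 + a..int M + a}" and "Y = {1..int M}"
  have "(\<Sum>z\<in>{1..int M}. \<phi> (z + a)) = sum \<phi> X"
    unfolding X_def by (rule sum.reindex_bij_witness[where i = "\<lambda>y. y - a" and j = "\<lambda>x. x + a"]) auto
  moreover have "sum \<phi> X = sum \<phi> (X - Y) + sum \<phi> (X \<inter> Y)" "sum \<phi> Y = sum \<phi> (Y - X) + sum \<phi> (X \<inter> Y)"
    by (metis X_def Y_def finite_atLeastAtMost_int inf.commute sum.Int_Diff add.commute)+
  moreover have "\<bar>sum \<phi> Z\<bar> \<le> real_of_int \<bar>a\<bar> * b" if "finite Z" "card Z \<le> nat \<bar>a\<bar>" for Z
  proof -
    have "\<bar>sum \<phi> Z\<bar> \<le> real (card Z) * b"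
      using sum_norm_bound[of Z \<phi> b] bnd by simp
    also have "\<dots> \<le> real_of_int \<bar>a\<bar> * b"
      by (intro mult_right_mono b) (use that in linarith)
    finally show ?thesis .
  qed
  moreover have "card (X - Y) \<le> nat \<bar>a\<bar>"
  proof -
    have "X - Y \<subseteq> (if a \<ge> 0 then {int M + 1..int M + a} else {1 + a..0})"
      by (auto simp: X_def Y_def)
    then have "card (X - Y) \<le> card (if a \<ge> 0 then {int M + 1..int M + a} else {1 + a..0})"
      by (intro card_mono) auto
    then show ?thesis by (auto split: if_splits)
  qed
  moreover have "card (Y - X) \<le> nat \<bar>a\<bar>"
  proof -
    have "Y - X \<subseteq> (if a \<ge> 0 then {1..a} else {int M + a + 1..int M})"
      by (auto simp: X_def Y_def)
    then have "card (Y - X) \<le> card (if a \<ge> 0 then {1..a} else {int M + a + 1..int M})"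
      by (intro card_mono) auto
    then show ?thesis by (auto split: if_splits)
  qed
  moreover have "finite (X - Y)" "finite (Y - X)" by (auto simp: X_def Y_def)
  ultimately have "\<bar>sum \<phi> X - sum \<phi> Y\<bar> \<le> 2 * (real_of_int \<bar>a\<bar> * b)" "(\<Sum>z\<in>Y. \<phi> (z + a)) = sum \<phi> X"
    unfolding Y_def by (smt (verit))+
  then show ?thesis unfolding Y_def[symmetric] by simp
qed

text \<open>The variables are shifted one at a time: moving \<open>w\<close> costs
  \<open>4 * U * M * b\<close>, moving \<open>z\<close> costs \<open>2 * U * M * b\<close>.\<close>

lemma abs_sum2_shift_diff_le:
  fixes \<psi> :: "int \<Rightarrow> real"
  assumes bnd: "\<And>z. \<bar>\<psi> z\<bar> \<le> b" and ab: "\<bar>a\<bar> \<le> U" "\<bar>a'\<bar> \<le> 2 * U"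
  shows "\<bar>(\<Sum>z\<in>{1..int M}. \<Sum>w\<in>{1..int M}. \<psi> (c + u * (z + a) + v * (w + a')))
     - (\<Sum>z\<in>{1..int M}. \<Sum>w\<in>{1..int M}. \<psi> (c + u * z + v * w))\<bar> \<le> 6 * real_of_int U * real M * b"
proof -
  have b: "b \<ge> 0" using bnd[of 0] by linarith
  let ?I = "{1..int M}"
  let ?A = "\<Sum>z\<in>?I. \<Sum>w\<in>?I. \<psi> (c + u * (z + a) + v * (w + a'))"
  let ?B = "\<Sum>z\<in>?I. \<Sum>w\<in>?I. \<psi> (c + u * (z + a) + v * w)"
  let ?C = "\<Sum>z\<in>?I. \<Sum>w\<in>?I. \<psi> (c + u * z + v * w)"
  have "\<bar>?A - ?B\<bar> \<le> (\<Sum>z\<in>?I. \<bar>(\<Sum>w\<in>?I. \<psi> (c + u * (z + a) + v * (w + a'))) - (\<Sum>w\<in>?I. \<psi> (c + u * (z + a) + v * w))\<bar>)"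
    unfolding sum_subtractf[symmetric] by (rule sum_abs)
  also have "\<dots> \<le> (\<Sum>z\<in>?I. 2 * real_of_int \<bar>a'\<bar> * b)"
    by (intro sum_mono abs_sum_shift_diff_le bnd)
  also have "\<dots> = real M * (2 * real_of_int \<bar>a'\<bar> * b)" by simp
  also have "\<dots> \<le> real M * (2 * real_of_int (2 * U) * b)"
    using ab b by (intro mult_left_mono mult_right_mono) (auto simp flip: of_int_mult)
  finally have 1: "\<bar>?A - ?B\<bar> \<le> real M * (4 * real_of_int U * b)" by simp
  have "\<bar>(\<Sum>w\<in>?I. \<psi> (c + u * z + v * w))\<bar> \<le> real M * b" for z
    using sum_norm_bound[of ?I "\<lambda>w. \<psi> (c + u * z + v * w)" b] bnd by simp
  from abs_sum_shift_diff_le[of "\<lambda>z. \<Sum>w\<in>?I. \<psi> (c + u * z + v * w)", OF this, where M = M and a = a]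
  have "\<bar>?B - ?C\<bar> \<le> 2 * real_of_int \<bar>a\<bar> * (real M * b)" .
  also have "\<dots> \<le> 2 * real_of_int U * (real M * b)"
    using ab b by (intro mult_right_mono mult_left_mono) auto
  finally show ?thesis using 1 by (simp add: algebra_simps)
qed

text \<open>By Bezout, a translation by \<open>2 gcd u v s\<close> can be absorbed into small shifts of \<open>z\<close> and \<open>w\<close>, so the
  box sum hardly changes when it is averaged over such translations.\<close>

lemma corr_box_le:
  fixes f :: "int \<Rightarrow> real" and u v U :: int
  assumes per: "\<And>x. f (x + int L) = f x" and "L > 0" and bnd: "\<And>x. \<bar>f x\<bar> \<le> 1"
    and "v \<noteq> 0" "\<bar>u\<bar> \<le> U" "\<bar>v\<bar> \<le> U" "gcd u v * int S \<le> U * \<bar>v\<bar>" "S > 0"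
    and E: "(\<Sum>x\<in>{0..<int L}. \<bar>\<Sum>s\<in>{0..<int S}. f (x + 2 * gcd u v * s)\<bar>) \<le> \<epsilon> * real L * real S"
  shows "(\<Sum>z\<in>{1..int M}. \<Sum>w\<in>{1..int M}. corr L f (c + 2 * u * z + 2 * v * w))
     \<le> \<epsilon> * real L * (real M)\<^sup>2 + 6 * real_of_int U * real M * real L"
proof -
  let ?I = "{1..int M}"
  let ?g = "gcd u v"
  let ?C = "\<Sum>z\<in>?I. \<Sum>w\<in>?I. corr L f (c + 2 * u * z + 2 * v * w)"
  let ?e = "6 * real_of_int U * real M * real L"
  have shift: "?C \<le> (\<Sum>z\<in>?I. \<Sum>w\<in>?I. corr L f (c + 2 * u * z + 2 * v * w + 2 * ?g * s)) + ?e"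
    if s: "s \<in> {0..<int S}" for s
  proof -
    have "?g * s \<le> ?g * int S" using s by (intro mult_left_mono) auto
    then have "\<bar>?g * s\<bar> \<le> U * \<bar>v\<bar>" using assms(7) s by (simp add: abs_mult)
    from bounded_bezout[OF assms(4-6) this]
    obtain a a' where a: "u * a + v * a' = ?g * s" "\<bar>a\<bar> \<le> U" "\<bar>a'\<bar> \<le> 2 * U" by blast
    have eq: "c + 2 * u * (z + a) + 2 * v * (w + a') = c + 2 * u * z + 2 * v * w + 2 * ?g * s" for z w
      using arg_cong[OF a(1), of "\<lambda>x. 2 * x"] by (simp add: algebra_simps)
    show ?thesis
      using abs_sum2_shift_diff_le[of "corr L f" "real L", OF abs_corr_le[OF bnd] a(2,3), where M = M and c = c and u = "2 * u" and v = "2 * v"]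
      unfolding eq by linarith
  qed
  \<comment> \<open>The sum over \<open>s\<close> is moved onto one factor of the correlation. The
    other factor is at most 1 in absolute value, so the L^1 norm in \<open>E\<close> remains, and
    periodicity removes the translation by \<open>t\<close>.\<close>
  have inner: "(\<Sum>s\<in>{0..<int S}. corr L f (t + 2 * ?g * s)) \<le> \<epsilon> * real L * real S" for t
  proof -
    have "(\<Sum>s\<in>{0..<int S}. corr L f (t + 2 * ?g * s))
        = (\<Sum>x\<in>{0..<int L}. f x * (\<Sum>s\<in>{0..<int S}. f (x + t + 2 * ?g * s)))"
      unfolding corr_def by (subst sum.swap) (simp add: sum_distrib_left add.assoc)
    also have "\<dots> \<le> (\<Sum>x\<in>{0..<int L}. \<bar>\<Sum>s\<in>{0..<int S}. f (x + t + 2 * ?g * s)\<bar>)"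
    proof (intro sum_mono)
      fix x
      let ?y = "\<Sum>s\<in>{0..<int S}. f (x + t + 2 * ?g * s)"
      have "f x * ?y \<le> \<bar>f x\<bar> * \<bar>?y\<bar>" by (metis abs_ge_self abs_mult)
      also have "\<dots> \<le> \<bar>?y\<bar>" using bnd[of x] by (simp add: mult_left_le_one_le)
      finally show "f x * ?y \<le> \<bar>?y\<bar>" .
    qed
    also have "\<dots> = (\<Sum>x\<in>{0..<int L}. \<bar>\<Sum>s\<in>{0..<int S}. f (x + 2 * ?g * s)\<bar>)"
    proof (rule sum_periodic_shift[where f = "\<lambda>x. \<bar>\<Sum>s\<in>{0..<int S}. f (x + 2 * ?g * s)\<bar>"])
      show "\<bar>\<Sum>s\<in>{0..<int S}. f (x + int L + 2 * ?g * s)\<bar> = \<bar>\<Sum>s\<in>{0..<int S}. f (x + 2 * ?g * s)\<bar>" for x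
        using per[of "x + 2 * ?g * _"] by (simp add: algebra_simps)
    qed fact
    finally show ?thesis using E by linarith
  qed
  have "real S * ?C = (\<Sum>s\<in>{0..<int S}. ?C)" by simp
  also have "\<dots> \<le> (\<Sum>s\<in>{0..<int S}. (\<Sum>z\<in>?I. \<Sum>w\<in>?I. corr L f (c + 2 * u * z + 2 * v * w + 2 * ?g * s)) + ?e)"
    by (intro sum_mono shift)
  also have "\<dots> = (\<Sum>z\<in>?I. \<Sum>w\<in>?I. \<Sum>s\<in>{0..<int S}. corr L f (c + 2 * u * z + 2 * v * w + 2 * ?g * s)) + real S * ?e"
    unfolding sum.distrib
    by (subst sum.swap, subst (2) sum.swap) simp
  also have "\<dots> \<le> (\<Sum>z\<in>?I. \<Sum>w\<in>?I. \<epsilon> * real L * real S) + real S * ?e"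
    by (intro add_right_mono sum_mono inner)
  also have "\<dots> = real S * (\<epsilon> * real L * (real M)\<^sup>2 + ?e)"
    by (simp add: power2_eq_square algebra_simps)
  finally show ?thesis using \<open>S > 0\<close> by simp
qed

section \<open>Nodes with small greatest common divisors, and the second Cauchy-Schwarz step\<close>

text \<open>Differences of nodes \<open>i Y + i\<^sup>2\<close> are \<open>(a - i) (Y + a + i)\<close>. The second factors for different \<open>a\<close>
  differ by little, which bounds the greatest common divisors independently of \<open>Y\<close>.\<close>

definition node :: "nat \<Rightarrow> int \<Rightarrow> int" where
  "node Y i = i * int Y + i\<^sup>2"

lemma gcd_node_diff_le:
  assumes "a \<in> {1..int K}" "b \<in> {1..int K}" "i \<in> {1..int K}" "a \<noteq> i" "b \<noteq> i" "a \<noteq> b"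
  shows "gcd (node Y i - node Y a) (node Y b - node Y i) \<le> int K ^ 3"
proof -
  let ?g = "gcd (node Y i - node Y a) (node Y b - node Y i)"
  \<comment> \<open>In this combination \<open>Y\<close> cancels and a Vandermonde product of size
    at most \<open>K ^ 3\<close> is left.\<close>
  have eq: "(b - i) * (node Y i - node Y a) + (a - i) * (node Y b - node Y i) = (a - i) * (b - i) * (b - a)"
    by (simp add: node_def power2_eq_square algebra_simps)
  have "?g dvd (b - i) * (node Y i - node Y a) + (a - i) * (node Y b - node Y i)"
    by (rule dvd_add[OF dvd_mult[OF gcd_dvd1] dvd_mult[OF gcd_dvd2]])
  then have dvd: "?g dvd (a - i) * (b - i) * (b - a)" unfolding eq .
  have "(a - i) * (b - i) * (b - a) \<noteq> 0" using assms(4-6) by simp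
  from dvd_imp_le_int[OF this dvd] have "?g \<le> \<bar>(a - i) * (b - i) * (b - a)\<bar>"
    by (rule order_trans[OF abs_ge_self])
  also have "\<dots> \<le> int K * int K * int K"
    unfolding abs_mult using assms by (intro mult_mono) auto
  finally show ?thesis by (simp add: power3_eq_cube)
qed

lemma node_bounds:
  assumes "j \<in> {1..int K}" "K \<le> Y"
  shows "0 \<le> node Y j" "node Y j \<le> 2 * int K * int Y"
proof -
  show "0 \<le> node Y j" using assms by (simp add: node_def)
  have "node Y j = j * (int Y + j)" by (simp add: node_def power2_eq_square algebra_simps)
  also have "\<dots> \<le> int K * (int Y + int Y)" using assms by (intro mult_mono) auto
  finally show "node Y j \<le> 2 * int K * int Y" by simp
qed

text \<open>The lower bound makes room in the Bezout argument for translations of order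
  \<open>Y ^ 2\<close>; the upper bound keeps the Bezout coefficients small compared with the side
  \<open>M\<close> of the box.\<close>

lemma node_diff_bounds:
  assumes "a \<in> {1..int K}" "i \<in> {1..int K}" "a \<noteq> i" "K \<le> Y"
  shows "int Y \<le> \<bar>node Y a - node Y i\<bar>" "\<bar>node Y a - node Y i\<bar> \<le> 2 * int K * int Y"
proof -
  have eq: "\<bar>node Y a - node Y i\<bar> = \<bar>a - i\<bar> * (int Y + a + i)"
  proof -
    have "node Y a - node Y i = (a - i) * (int Y + a + i)"
      by (simp add: node_def power2_eq_square algebra_simps)
    then show ?thesis using assms by (simp add: abs_mult)
  qed
  have "1 * int Y \<le> \<bar>a - i\<bar> * (int Y + a + i)" using assms by (intro mult_mono) auto
  then show "int Y \<le> \<bar>node Y a - node Y i\<bar>" by (simp add: eq)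
  show "\<bar>node Y a - node Y i\<bar> \<le> 2 * int K * int Y"
    using node_bounds[OF assms(1,4)] node_bounds[OF assms(2,4)] by linarith
qed

lemma abs_box_sum_le:
  assumes "\<And>t. \<bar>\<psi> t\<bar> \<le> (b::real)"
  shows "(\<Sum>z\<in>{1..int M}. \<Sum>w\<in>{1..int M}. \<psi> (\<phi> z w)) \<le> (real M)\<^sup>2 * b"
proof -
  have "(\<Sum>z\<in>{1..int M}. \<Sum>w\<in>{1..int M}. \<psi> (\<phi> z w)) \<le> (\<Sum>z\<in>{1..int M}. \<Sum>w\<in>{1..int M}. b)"
    by (intro sum_mono) (metis assms abs_le_D1)
  then show ?thesis by (simp add: power2_eq_square algebra_simps)
qed

text \<open>For fixed \<open>a\<close> and \<open>i\<close> the shift \<open>\<tau> (a, z)\<close>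
  is already linear in \<open>z\<close>. Cauchy-Schwarz with weight \<open>f\<close> turns the sum
  into correlations at \<open>\<tau> (b, w) - \<tau> (a, z)\<close>, linear in two independent
  variables. Hypothesis \<open>E\<close>, which says that \<open>f\<close> has small averages along
  most progressions of difference \<open>2 * g\<close>, then controls all pairs \<open>a\<close>,
  \<open>b\<close> but the few degenerate ones.\<close>

lemma sum_corr_square_diff_le:
  fixes f :: "int \<Rightarrow> real" and K Y M y :: nat
  assumes per: "\<And>x. f (x + int L) = f x" and "L > 0" and bnd: "\<And>x. \<bar>f x\<bar> \<le> 1"
    and "K \<ge> 1" "y \<ge> 1" and Y: "Y = K ^ 3 * y" and M: "M = 4 * K\<^sup>2 * Y"
    and E: "\<And>g. g \<in> {1..K ^ 3} \<Longrightarrow>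
      (\<Sum>x\<in>{0..<int L}. \<bar>\<Sum>s\<in>{0..<int (2 * g * y\<^sup>2)}. f (x + 2 * int g * s)\<bar>)
        \<le> 3 / real K * real L * real (2 * g * y\<^sup>2)"
    and i: "i \<in> {1..int K}"
  shows "(\<Sum>a\<in>{1..int K}. \<Sum>z\<in>{1..int M}. corr L f ((z + node Y a)\<^sup>2 - (z + node Y i)\<^sup>2))\<^sup>2
     \<le> 9 * real K * (real M)\<^sup>2 * (real L)\<^sup>2"
proof -
  define U where "U = 2 * int K * int Y"
  define \<tau> where "\<tau> = (\<lambda>(a, z). (z + node Y a)\<^sup>2 - (z + node Y i)\<^sup>2)"
  let ?I = "{1..int K}" and ?J = "{1..int M}"
  let ?P = "?I \<times> ?J"
  let ?V = "\<Sum>a\<in>?I. \<Sum>z\<in>?J. corr L f ((z + node Y a)\<^sup>2 - (z + node Y i)\<^sup>2)"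
  let ?W = "\<Sum>p\<in>?P. \<Sum>p'\<in>?P. corr L f (\<tau> p' - \<tau> p)"
  have KY: "K \<le> Y" "Y > 0"
    using \<open>K \<ge> 1\<close> \<open>y \<ge> 1\<close> self_le_power[of K 3] unfolding Y
    by (auto intro: order_trans[of K "K ^ 3" "K ^ 3 * y"])
  have V: "?V = (\<Sum>x\<in>{0..<int L}. f x * (\<Sum>p\<in>?P. f (x + \<tau> p)))"
  proof -
    have "?V = (\<Sum>p\<in>?P. corr L f (\<tau> p))"
      by (simp add: sum.cartesian_product \<tau>_def case_prod_beta)
    also have "\<dots> = (\<Sum>x\<in>{0..<int L}. f x * (\<Sum>p\<in>?P. f (x + \<tau> p)))"
      unfolding corr_def by (subst sum.swap) (simp add: sum_distrib_left)
    finally show ?thesis .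
  qed
  \<comment> \<open>A generic pair contributes the proportion \<open>6 / K\<close> of the trivial
    bound. Each of the coincidences \<open>a = i\<close>, \<open>b = i\<close>, \<open>a = b\<close>
    allows the full trivial bound but occurs for only \<open>K\<close> pairs, so the total is
    \<open>6 * K + 3 * K\<close>.\<close>
  let ?ind = "\<lambda>a b. 6 / real K + of_bool (a = i) + of_bool (b = i) + of_bool (a = b) :: real"
  have pair: "(\<Sum>z\<in>?J. \<Sum>w\<in>?J. corr L f (\<tau> (b, w) - \<tau> (a, z))) \<le> ?ind a b * ((real M)\<^sup>2 * real L)"
    if ab: "a \<in> ?I" "b \<in> ?I" for a b
  proof (cases "a = i \<or> b = i \<or> a = b")
    case True
    have "(\<Sum>z\<in>?J. \<Sum>w\<in>?J. corr L f (\<tau> (b, w) - \<tau> (a, z))) \<le> 1 * ((real M)\<^sup>2 * real L)"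
      using abs_box_sum_le[OF abs_corr_le[OF bnd]] by simp
    also have "\<dots> \<le> ?ind a b * ((real M)\<^sup>2 * real L)"
      by (intro mult_right_mono) (use True in auto)
    finally show ?thesis .
  next
    case False
    define u v where "u = node Y i - node Y a" and "v = node Y b - node Y i"
    define g where "g = nat (gcd u v)"
    have u: "int Y \<le> \<bar>u\<bar>" "\<bar>u\<bar> \<le> U" and v: "int Y \<le> \<bar>v\<bar>" "\<bar>v\<bar> \<le> U"
      using node_diff_bounds[of _ K _ Y] ab i False KY by (auto simp: u_def v_def U_def)
    have g: "int g = gcd u v" "g \<le> K ^ 3" "g \<ge> 1"
    proof -
      show *: "int g = gcd u v" by (simp add: g_def)
      show "g \<le> K ^ 3"
        using gcd_node_diff_le[of a K b i Y] ab i False * unfolding u_def v_def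
        by (metis of_nat_le_iff of_nat_power)
      have "gcd u v > 0" using v(1) KY by (auto simp: gcd_pos_int)
      then show "g \<ge> 1" using * by linarith
    qed
    \<comment> \<open>The left side is \<open>2 * g ^ 2 * y ^ 2\<close>, which is at most
      \<open>2 * Y ^ 2\<close> because \<open>g \<le> K ^ 3\<close> and
      \<open>Y = K ^ 3 * y\<close>.\<close>
    have "gcd u v * int (2 * g * y\<^sup>2) \<le> U * \<bar>v\<bar>"
    proof -
      have "int g * int (2 * g * y\<^sup>2) = 2 * (int g * int g * (int y)\<^sup>2)"
        by (simp add: power2_eq_square)
      also have "\<dots> \<le> 2 * (int (K ^ 3) * int (K ^ 3) * (int y)\<^sup>2)"
        using of_nat_mono[OF g(2), where 'a = int] by (intro mult_left_mono mult_right_mono mult_mono) auto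
      also have "\<dots> = 2 * (1 * int Y * int Y)" by (simp add: Y power2_eq_square)
      also have "\<dots> \<le> 2 * (int K * int Y * int Y)"
        using \<open>K \<ge> 1\<close> by (intro mult_left_mono mult_right_mono) auto
      also have "\<dots> = U * int Y" by (simp add: U_def)
      also have "\<dots> \<le> U * \<bar>v\<bar>" using v by (intro mult_left_mono) (auto simp: U_def)
      finally show ?thesis using g by simp
    qed
    moreover have "2 * g * y\<^sup>2 > 0" using g \<open>y \<ge> 1\<close> by simp
    moreover have "(\<Sum>x\<in>{0..<int L}. \<bar>\<Sum>s\<in>{0..<int (2 * g * y\<^sup>2)}. f (x + 2 * gcd u v * s)\<bar>)
        \<le> 3 / real K * real L * real (2 * g * y\<^sup>2)"
      using E[of g] g by simp
    moreover have "v \<noteq> 0" using v KY by auto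
    moreover have "\<tau> (b, w) - \<tau> (a, z) = ((node Y b)\<^sup>2 - (node Y a)\<^sup>2) + 2 * u * z + 2 * v * w" for z w
      by (simp add: \<tau>_def u_def v_def power2_eq_square algebra_simps)
    ultimately have "(\<Sum>z\<in>?J. \<Sum>w\<in>?J. corr L f (\<tau> (b, w) - \<tau> (a, z)))
        \<le> 3 / real K * real L * (real M)\<^sup>2 + 6 * real_of_int U * real M * real L"
      by (simp only:) (rule corr_box_le[of f L, OF per \<open>L > 0\<close> bnd _ u(2) v(2)])
    \<comment> \<open>The side \<open>M = 4 * K ^ 2 * Y\<close> is chosen so that the boundary error
      equals the main term \<open>3 / K\<close>.\<close>
    also have "6 * real_of_int U = 3 / real K * real M"
      using \<open>K \<ge> 1\<close> by (simp add: U_def M field_simps power2_eq_square)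
    finally show ?thesis using False by (simp add: power2_eq_square field_simps)
  qed
  have "?W = (\<Sum>a\<in>?I. \<Sum>z\<in>?J. \<Sum>b\<in>?I. \<Sum>w\<in>?J. corr L f (\<tau> (b, w) - \<tau> (a, z)))"
    by (simp only: sum.cartesian_product')
  also have "\<dots> = (\<Sum>a\<in>?I. \<Sum>b\<in>?I. \<Sum>z\<in>?J. \<Sum>w\<in>?J. corr L f (\<tau> (b, w) - \<tau> (a, z)))"
    by (rule sum.cong[OF refl], rule sum.swap)
  also have "\<dots> \<le> (\<Sum>a\<in>?I. \<Sum>b\<in>?I. ?ind a b * ((real M)\<^sup>2 * real L))"
    by (intro sum_mono pair)
  also have "\<dots> = (\<Sum>a\<in>?I. \<Sum>b\<in>?I. ?ind a b) * ((real M)\<^sup>2 * real L)"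
    by (simp add: sum_distrib_right)
  also have "(\<Sum>a\<in>?I. \<Sum>b\<in>?I. ?ind a b) = 9 * real K"
  proof -
    have "(\<Sum>a\<in>?I. of_bool (a = i) :: real) = 1" "(\<Sum>a\<in>?I. of_bool (b = a) :: real) = 1" if "b \<in> ?I" for b
      using i that by (simp_all add: of_bool_def)
    then have "(\<Sum>b\<in>?I. ?ind a b) = 6 + real K * of_bool (a = i) + 2" if "a \<in> ?I" for a
      using i that \<open>K \<ge> 1\<close> by (simp add: sum.distrib distrib_left)
    then have "(\<Sum>a\<in>?I. \<Sum>b\<in>?I. ?ind a b) = (\<Sum>a\<in>?I. 6 + real K * of_bool (a = i) + 2)" by simp
    also have "\<dots> = 9 * real K"
      using i by (simp add: sum.distrib sum_distrib_left[symmetric] of_bool_def)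
    finally show ?thesis .
  qed
  finally have W: "?W \<le> 9 * real K * ((real M)\<^sup>2 * real L)" .
  have f2: "(\<Sum>x\<in>{0..<int L}. (f x)\<^sup>2) \<le> real L"
  proof -
    have "(\<Sum>x\<in>{0..<int L}. (f x)\<^sup>2) \<le> (\<Sum>x\<in>{0..<int L}. 1)"
      by (intro sum_mono) (simp add: abs_square_le_1 bnd)
    then show ?thesis by simp
  qed
  have "?V\<^sup>2 \<le> (\<Sum>x\<in>{0..<int L}. (f x)\<^sup>2) * ?W"
    unfolding V by (rule sum_mult_sum_square_le[of f L, OF per \<open>L > 0\<close>])
  also have "\<dots> \<le> (\<Sum>x\<in>{0..<int L}. (f x)\<^sup>2) * (9 * real K * ((real M)\<^sup>2 * real L))"
    by (intro mult_left_mono W sum_nonneg) simp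
  also have "\<dots> \<le> real L * (9 * real K * ((real M)\<^sup>2 * real L))"
    by (intro mult_right_mono f2) simp
  finally show ?thesis by (simp add: power2_eq_square algebra_simps)
qed

section \<open>The balanced function and the density increment\<close>

text \<open>The indicator is extended periodically so that sums over a period are translation
  invariant. The price is that a translate may wrap around; later steps restrict the starting points
  to exclude this.\<close>

definition balanced :: "nat \<Rightarrow> int set \<Rightarrow> int \<Rightarrow> real" where
  "balanced L B x = of_bool (x mod int L \<in> B) - real (card B) / real L"

lemma balanced_periodic: "balanced L B (x + int L) = balanced L B x"
  by (simp add: balanced_def)

lemma card_subset_interval:
  assumes "B \<subseteq> {0..<int L}"
  shows "finite B" "card B \<le> L"
  using assms card_mono[OF _ assms] by (auto intro: finite_subset)

lemma abs_balanced_le: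
  assumes "B \<subseteq> {0..<int L}"
  shows "\<bar>balanced L B x\<bar> \<le> 1"
proof -
  have "real (card B) / real L \<le> 1" "real (card B) / real L \<ge> 0"
    using card_subset_interval[OF assms] by (auto simp: divide_le_eq)
  then show ?thesis by (auto simp: balanced_def of_bool_def)
qed

lemma sum_balanced:
  assumes "B \<subseteq> {0..<int L}" "L > 0"
  shows "(\<Sum>x\<in>{0..<int L}. balanced L B x) = 0"
proof -
  have "(\<Sum>x\<in>{0..<int L}. balanced L B x) = (\<Sum>x\<in>{0..<int L}. of_bool (x \<in> B)) - real (card B)"
    using assms(2) by (simp add: balanced_def sum_subtractf)
  also have "(\<Sum>x\<in>{0..<int L}. of_bool (x \<in> B)) = real (card B)"
    using assms(1) by (simp add: Int_absorb1)
  finally show ?thesis by simp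
qed

text \<open>As \<open>G\<close> has mean zero, its L^1 norm is twice the mass of its positive part.
  The last \<open>r\<close> starting points, from which a progression could wrap around, carry at
  most \<open>\<delta> * L * S\<close> of that mass, so a large value occurs elsewhere.\<close>

lemma exists_large_positive_average:
  fixes G :: "int \<Rightarrow> real"
  assumes "(\<Sum>x\<in>{0..<int L}. G x) = 0" and le: "\<And>x. G x \<le> S"
    and "R \<le> \<delta> * real L" "\<delta> > 0" "S \<ge> 0"
    and large: "6 * \<delta> * real L * S < (\<Sum>x\<in>{0..<int L}. \<bar>G x\<bar>)"
    and R: "real_of_int r = R" "0 \<le> r"
  shows "\<exists>x\<in>{0..<int L - r}. \<delta> * S < G x"
proof (rule ccontr)
  assume "\<not> ?thesis"
  then have small: "G x \<le> \<delta> * S" if "x \<in> {0..<int L - r}" for x using that by force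
  have "(\<Sum>x\<in>{0..<int L}. \<bar>G x\<bar>) = (\<Sum>x\<in>{0..<int L}. 2 * max (G x) 0 - G x)"
    by (intro sum.cong) auto
  also have "\<dots> = 2 * (\<Sum>x\<in>{0..<int L}. max (G x) 0)"
    by (simp add: sum_subtractf assms(1) sum_distrib_left)
  also have "(\<Sum>x\<in>{0..<int L}. max (G x) 0) \<le> (\<Sum>x\<in>{0..<int L}. \<delta> * S + of_bool (int L - r \<le> x) * S)"
    using small le \<open>\<delta> > 0\<close> \<open>S \<ge> 0\<close> by (intro sum_mono) (force simp: add_increasing)
  also have "\<dots> = real L * (\<delta> * S) + real (card {x \<in> {0..<int L}. int L - r \<le> x}) * S"
    by (simp add: sum.distrib sum_distrib_right[symmetric] Int_def)
  also have "real (card {x \<in> {0..<int L}. int L - r \<le> x}) \<le> R"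
  proof -
    have "card {x \<in> {0..<int L}. int L - r \<le> x} \<le> card {int L - r..<int L}"
      by (intro card_mono) auto
    then show ?thesis using R by simp
  qed
  finally have "(\<Sum>x\<in>{0..<int L}. \<bar>G x\<bar>) \<le> 2 * (real L * (\<delta> * S) + R * S)"
    using \<open>S \<ge> 0\<close> by (simp add: mult_right_mono)
  also have "\<dots> \<le> 2 * (real L * (\<delta> * S) + \<delta> * real L * S)"
    by (intro mult_left_mono add_left_mono mult_right_mono assms) simp
  also have "\<dots> \<le> 6 * \<delta> * real L * S"
    using \<open>\<delta> > 0\<close> \<open>S \<ge> 0\<close> by simp
  finally show False using large by simp
qed

text \<open>A large L^1 norm of averages gives one progression of difference \<open>2 * g\<close> on
  which \<open>B\<close> is denser. It is cut into \<open>2 * g\<close> progressions whose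
  difference is the square of \<open>2 * g\<close>, and one of them is at least as dense as the
  whole. The square is wanted so that squares in the new coordinate are squares in the old
  one.\<close>

lemma density_increment:
  assumes B: "B \<subseteq> {0..<int L}" and "L > 0" "K \<ge> 1" "y \<ge> 1" and g: "g \<in> {1..K ^ 3}"
    and L: "(16 * K ^ 6 * y)\<^sup>2 \<le> L"
    and large: "3 / real K * real L * real (2 * g * y\<^sup>2)
      < (\<Sum>x\<in>{0..<int L}. \<bar>\<Sum>s\<in>{0..<int (2 * g * y\<^sup>2)}. balanced L B (x + 2 * int g * s)\<bar>)"
  shows "\<exists>a. (real (card B) / real L + 1 / (2 * real K)) * real (y\<^sup>2)
    \<le> real (card {t \<in> {0..<int (y\<^sup>2)}. a + (int (2 * g))\<^sup>2 * t \<in> B})"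
proof -
  define S where "S = 2 * g * y\<^sup>2"
  define G where "G x = (\<Sum>s\<in>{0..<int S}. balanced L B (x + 2 * int g * s))" for x
  define r where "r = 2 * int g * int S"
  have "(\<Sum>x\<in>{0..<int L}. G x) = (\<Sum>s\<in>{0..<int S}. \<Sum>x\<in>{0..<int L}. balanced L B (x + 2 * int g * s))"
    unfolding G_def by (rule sum.swap)
  also have "\<dots> = 0"
    by (simp only: sum_periodic_shift[of "balanced L B" L, OF balanced_periodic \<open>L > 0\<close>]
        sum_balanced[OF B \<open>L > 0\<close>] sum.neutral_const)
  finally have G0: "(\<Sum>x\<in>{0..<int L}. G x) = 0" .
  have "G x \<le> real S" for x
  proof -
    have "G x \<le> (\<Sum>s\<in>{0..<int S}. 1)" unfolding G_def
      by (intro sum_mono) (use abs_balanced_le[OF B] abs_le_D1 in blast)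
    then show ?thesis by simp
  qed
  moreover have "real_of_int r \<le> 1 / (2 * real K) * real L"
  proof -
    have "g * g \<le> K ^ 3 * K ^ 3" using g by (intro mult_mono) auto
    then have "g\<^sup>2 \<le> K ^ 6" by (simp add: power2_eq_square flip: power_add)
    then have "2 * K * (2 * g * S) \<le> 8 * K * K ^ 6 * y\<^sup>2"
      by (simp add: S_def power2_eq_square)
    also have "\<dots> = 8 * K ^ 7 * y\<^sup>2" using power_add[of K 1 6] by simp
    also have "\<dots> \<le> 256 * K ^ 12 * y\<^sup>2"
      using \<open>K \<ge> 1\<close> by (intro mult_right_mono mult_mono power_increasing) auto
    also have "\<dots> = (16 * K ^ 6 * y)\<^sup>2" by (simp add: power_mult_distrib flip: power_mult)
    also note L
    finally have "real (2 * K * (2 * g * S)) \<le> real L" by (rule of_nat_mono)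
    then show ?thesis using \<open>K \<ge> 1\<close> by (simp add: r_def field_simps)
  qed
  \<comment> \<open>The threshold \<open>3 / K\<close> is six times the gain
    \<open>1 / (2 * K)\<close>, as the extraction of a positive average requires.\<close>
  moreover have "6 * (1 / (2 * real K)) * real L * real S < (\<Sum>x\<in>{0..<int L}. \<bar>G x\<bar>)"
    using large by (simp add: S_def G_def)
  ultimately obtain x where x: "x \<in> {0..<int L - r}" "1 / (2 * real K) * real S < G x"
    using exists_large_positive_average[OF G0, of "real S" "real_of_int r" "1 / (2 * real K)" r] \<open>K \<ge> 1\<close>
    by (auto simp: r_def)
  let ?\<beta> = "real (card B) / real L"
  have no_wrap: "(x + 2 * int g * s) mod int L = x + 2 * int g * s" if "s \<in> {0..<int S}" for s
  proof -
    have "2 * int g * s \<le> r" unfolding r_def using that by (intro mult_left_mono) auto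
    then show ?thesis using x(1) that by (intro mod_pos_pos_trivial) auto
  qed
  have "G x = (\<Sum>s\<in>{0..<int S}. of_bool (x + 2 * int g * s \<in> B)) - ?\<beta> * real S"
    unfolding G_def balanced_def using no_wrap by (simp add: sum_subtractf)
  then have lower: "(?\<beta> + 1 / (2 * real K)) * real S < (\<Sum>s\<in>{0..<int S}. of_bool (x + 2 * int g * s \<in> B))"
    using x(2) by (simp add: algebra_simps)
  define c where "c \<rho> = {t \<in> {0..<int (y\<^sup>2)}. (x + 2 * int g * \<rho>) + (int (2 * g))\<^sup>2 * t \<in> B}" for \<rho>
  have "(\<Sum>s\<in>{0..<int S}. of_bool (x + 2 * int g * s \<in> B) :: real)
      = (\<Sum>(\<rho>, t)\<in>{0..<2 * int g} \<times> {0..<int (y\<^sup>2)}. of_bool (x + 2 * int g * (\<rho> + 2 * int g * t) \<in> B))"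
  proof (rule sum.reindex_bij_witness[where i = "\<lambda>(\<rho>, t). \<rho> + 2 * int g * t"
        and j = "\<lambda>s. (s mod (2 * int g), s div (2 * int g))"], goal_cases)
    case (2 s)
    have "s < int (y\<^sup>2) * (2 * int g)" using 2 by (simp add: S_def mult.commute mult.left_commute)
    then have "s div (2 * int g) < int (y\<^sup>2)"
    proof -
      have "s div (2 * int g) * (2 * int g) \<le> s"
      proof -
        have "0 \<le> s mod (2 * int g)" using g by simp
        then show ?thesis using div_mult_mod_eq[of s "2 * int g"] by linarith
      qed
      then have "s div (2 * int g) * (2 * int g) < int (y\<^sup>2) * (2 * int g)"
        using \<open>s < _\<close> by linarith
      then show ?thesis using g by (simp only: mult_less_cancel_right)
    qed
    then show ?case using 2 g by (simp add: pos_imp_zdiv_nonneg_iff)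
  next
    case (4 p)
    obtain \<rho> t where p: "p = (\<rho>, t)" "0 \<le> \<rho>" "\<rho> < 2 * int g" "0 \<le> t" "t + 1 \<le> int (y\<^sup>2)" using 4 by auto
    have "\<rho> + 2 * int g * t < 2 * int g * (t + 1)" using p by (simp add: algebra_simps)
    also have "\<dots> \<le> 2 * int g * int (y\<^sup>2)" using p by (intro mult_left_mono) auto
    finally show ?case using p by (simp add: S_def)
  qed (auto simp: div_add1_eq)
  also have "\<dots> = (\<Sum>\<rho>\<in>{0..<2 * int g}. \<Sum>t\<in>{0..<int (y\<^sup>2)}. of_bool (x + 2 * int g * (\<rho> + 2 * int g * t) \<in> B))"
    by (simp add: sum.cartesian_product')
  also have "\<dots> = (\<Sum>\<rho>\<in>{0..<2 * int g}. real (card (c \<rho>)))"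
    by (simp add: c_def Int_def power2_eq_square algebra_simps)
  finally have eq: "(\<Sum>s\<in>{0..<int S}. of_bool (x + 2 * int g * s \<in> B) :: real) = (\<Sum>\<rho>\<in>{0..<2 * int g}. real (card (c \<rho>)))" .
  have "\<exists>\<rho>. (?\<beta> + 1 / (2 * real K)) * real (y\<^sup>2) \<le> real (card (c \<rho>))"
  proof (rule ccontr)
    assume "\<not> ?thesis"
    then have "(\<Sum>\<rho>\<in>{0..<2 * int g}. real (card (c \<rho>))) \<le> (\<Sum>\<rho>\<in>{0..<2 * int g}. (?\<beta> + 1 / (2 * real K)) * real (y\<^sup>2))"
      by (intro sum_mono) (simp add: not_le less_imp_le)
    also have "\<dots> = (?\<beta> + 1 / (2 * real K)) * real S" by (simp add: S_def nat_mult_distrib)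
    finally show False using lower eq by linarith
  qed
  then show ?thesis unfolding c_def by blast
qed

section \<open>Many square differences, or an increment\<close>

text \<open>\<open>T z\<close> is the excess, over the expected value, of the number of pairs
  \<open>x\<close>, \<open>i\<close> with \<open>x\<close> in \<open>B1\<close> and
  \<open>x + (z + node Y i) ^ 2\<close> in \<open>B\<close>. Two uses of Cauchy-Schwarz show that
  its sum over \<open>z\<close> is small. If only few roots \<open>z\<close> occurred, the counts
  would mostly vanish and this sum would be strongly negative.\<close>

lemma many_square_differences:
  fixes n K L y :: nat
  assumes B: "B \<subseteq> {0..<int L}" and "n \<ge> 1" and K: "K = 784 * n ^ 6" and "y \<ge> 1"
    and L: "(16 * K ^ 6 * y)\<^sup>2 \<le> L" and dens: "L \<le> n * card B"
    and E: "\<And>g. g \<in> {1..K ^ 3} \<Longrightarrow>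
      (\<Sum>x\<in>{0..<int L}. \<bar>\<Sum>s\<in>{0..<int (2 * g * y\<^sup>2)}. balanced L B (x + 2 * int g * s)\<bar>)
        \<le> 3 / real K * real L * real (2 * g * y\<^sup>2)"
  shows "8 * K ^ 5 * y \<le> 4 * n * card {z \<in> {1..int (8 * K ^ 5 * y)}. \<exists>x\<in>B. x + z\<^sup>2 \<in> B}"
proof -
  define Y where "Y = K ^ 3 * y"
  define M where "M = 4 * K\<^sup>2 * Y"
  define f where "f = balanced L B"
  define \<Delta> where "\<Delta> = (2 * M)\<^sup>2"
  \<comment> \<open>no wrap-around modulo \<open>L\<close> when a square is added to an element of \<open>B1\<close>\<close>
  define B1 where "B1 = {x \<in> B. x + int \<Delta> < int L}"
  define R where "R = {z \<in> {1..int (2 * M)}. \<exists>x\<in>B. x + z\<^sup>2 \<in> B}"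
  let ?\<beta> = "real (card B) / real L"
  let ?I = "{1..int K}" and ?J = "{1..int M}" and ?X = "{0..<int L}"
  have "K \<ge> 1" using \<open>n \<ge> 1\<close> K by simp
  have M_eq: "2 * M = 8 * K ^ 5 * y" by (simp add: M_def Y_def flip: power_add)
  have KY: "K \<le> Y" "Y > 0"
    using \<open>K \<ge> 1\<close> \<open>y \<ge> 1\<close> self_le_power[of K 3] unfolding Y_def
    by (auto intro: order_trans[of K "K ^ 3" "K ^ 3 * y"])
  have "M > 0" using \<open>K \<ge> 1\<close> KY by (simp add: M_def)
  have "(16 * K ^ 6 * y)\<^sup>2 > 0" using \<open>K \<ge> 1\<close> \<open>y \<ge> 1\<close> by simp
  with L have "L > 0" by linarith
  have fB: "finite B" using card_subset_interval[OF B] by simp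
  have per: "f (x + int L) = f x" for x by (simp add: f_def balanced_periodic)
  have bnd: "\<bar>f x\<bar> \<le> 1" for x unfolding f_def by (rule abs_balanced_le[OF B])
  have "finite R"
    unfolding R_def by (rule finite_subset[of _ "{1..int (2 * M)}"]) auto
  have B1: "B1 \<subseteq> B" "finite B1" using fB by (auto simp: B1_def)

  have \<Delta>: "2 * n * \<Delta> \<le> L"
  proof -
    have "n ^ 1 \<le> n ^ 6" using \<open>n \<ge> 1\<close> by (intro power_increasing) auto
    then have "n * 2 \<le> K" using K by simp
    also have "K \<le> K ^ 2" using \<open>K \<ge> 1\<close> by (simp add: power2_eq_square)
    finally have "2 * n * \<Delta> \<le> K ^ 2 * \<Delta>" by (intro mult_right_mono) auto
    also have "\<dots> = 64 * K ^ 12 * y\<^sup>2"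
      by (simp add: \<Delta>_def M_eq power_mult_distrib flip: power_mult power_add)
    also have "\<dots> \<le> (16 * K ^ 6 * y)\<^sup>2" by (simp add: power_mult_distrib flip: power_mult)
    finally show ?thesis using L by linarith
  qed
  \<comment> \<open>Only the last \<open>\<Delta>\<close> positions are lost, at most half of the
    lower bound \<open>L / n\<close> for \<open>card B\<close>.\<close>
  have cardB1: "L \<le> 2 * n * card B1"
  proof -
    have "B - B1 \<subseteq> {int L - int \<Delta>..<int L}" using B by (auto simp: B1_def)
    then have "card (B - B1) \<le> \<Delta>"
      using card_mono[of "{int L - int \<Delta>..<int L}" "B - B1"] by simp
    then have "card B \<le> card B1 + \<Delta>"
      using card_Diff_subset[OF B1(2,1)] card_mono[OF fB B1(1)] by linarith
    then have "2 * n * card B \<le> 2 * n * card B1 + 2 * n * \<Delta>"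
      by (metis distrib_left mult_le_mono2)
    then show ?thesis using \<Delta> dens by linarith
  qed
  then have "card B1 > 0" using \<open>L > 0\<close> by (metis mult_0_right not_gr_zero not_le)
  have node: "0 \<le> node Y i" "node Y i \<le> int M" if "i \<in> ?I" for i
  proof -
    have "2 * int K * int Y \<le> int M"
      using \<open>K \<ge> 1\<close> by (simp add: M_def power2_eq_square mult_right_mono)
    then show "0 \<le> node Y i" "node Y i \<le> int M"
      using node_bounds[OF that KY(1)] by auto
  qed

  define V where "V i = (\<Sum>a\<in>?I. \<Sum>z\<in>?J. corr L f ((z + node Y a)\<^sup>2 - (z + node Y i)\<^sup>2))" for i
  define T where "T z = (\<Sum>x\<in>?X. of_bool (x \<in> B1) * (\<Sum>i\<in>?I. f (x + (z + node Y i)\<^sup>2)))" for z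
  have V: "V i \<le> 84 * real n ^ 3 * real M * real L" if "i \<in> ?I" for i
  proof (rule power2_le_imp_le)
    have "(V i)\<^sup>2 \<le> 9 * real K * (real M)\<^sup>2 * (real L)\<^sup>2"
      unfolding V_def using E
      by (intro sum_corr_square_diff_le[of f L, OF per \<open>L > 0\<close> bnd \<open>K \<ge> 1\<close> \<open>y \<ge> 1\<close> Y_def M_def _ that])
         (auto simp: f_def)
    \<comment> \<open>The coefficient 784 makes \<open>9 * K\<close> the square of
      \<open>84 * n ^ 3\<close>.\<close>
    also have "\<dots> = (84 * real n ^ 3 * real M * real L)\<^sup>2"
      by (simp add: K power_mult_distrib flip: power_mult)
    finally show "(V i)\<^sup>2 \<le> (84 * real n ^ 3 * real M * real L)\<^sup>2" .
  qed simp
  \<comment> \<open>First use of Cauchy-Schwarz, for each \<open>z\<close> separately, with the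
    indicator of \<open>B1\<close> as weight. The remaining shifts are differences of two squares in
    which \<open>z ^ 2\<close> cancels.\<close>
  have "(\<Sum>z\<in>?J. (T z)\<^sup>2) \<le> real (card B1) * (\<Sum>i\<in>?I. V i)"
  proof -
    have one: "(\<Sum>x\<in>?X. (of_bool (x \<in> B1) :: real)\<^sup>2) = real (card B1)"
    proof -
      have "B1 \<subseteq> ?X" using B B1 by blast
      then show ?thesis by (simp add: Int_absorb1 power2_eq_square flip: of_bool_conj)
    qed
    have "(\<Sum>z\<in>?J. (T z)\<^sup>2) \<le> (\<Sum>z\<in>?J. real (card B1) *
        (\<Sum>i\<in>?I. \<Sum>a\<in>?I. corr L f ((z + node Y a)\<^sup>2 - (z + node Y i)\<^sup>2)))"
      unfolding one[symmetric] T_def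
      by (rule sum_mono, rule sum_mult_sum_square_le[of f L, OF per \<open>L > 0\<close>])
    also have "\<dots> = real (card B1) * (\<Sum>i\<in>?I. \<Sum>z\<in>?J. \<Sum>a\<in>?I. corr L f ((z + node Y a)\<^sup>2 - (z + node Y i)\<^sup>2))"
      unfolding sum_distrib_left[symmetric] by (subst sum.swap) simp
    also have "\<dots> = real (card B1) * (\<Sum>i\<in>?I. V i)"
      unfolding V_def by (subst (2) sum.swap) simp
    finally show ?thesis .
  qed
  also have "\<dots> \<le> real (card B1) * (\<Sum>i\<in>?I. 84 * real n ^ 3 * real M * real L)"
    by (intro mult_left_mono sum_mono V) auto
  also have "\<dots> = 84 * real n ^ 3 * real K * real M * real (card B1) * real L"
    by simp
  also have "\<dots> \<le> 84 * real n ^ 3 * real K * real M * real (card B1) * (2 * real n * real (card B1))"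
    using of_nat_mono[OF cardB1, where 'a = real] by (intro mult_left_mono) auto
  finally have sumT2: "(\<Sum>z\<in>?J. (T z)\<^sup>2) \<le> 168 * real n ^ 4 * real K * real M * (real (card B1))\<^sup>2"
    by (simp add: power2_eq_square eval_nat_numeral algebra_simps)
  have "\<bar>\<Sum>z\<in>?J. T z\<bar> \<le> real K * real M * real (card B1) / (2 * real n)"
  proof (rule abs_le_square_iff[THEN iffD2, THEN order_trans])
    show "(\<Sum>z\<in>?J. T z)\<^sup>2 \<le> (real K * real M * real (card B1) / (2 * real n))\<^sup>2"
    proof -
      have "(\<Sum>z\<in>?J. T z)\<^sup>2 \<le> real M * (\<Sum>z\<in>?J. (T z)\<^sup>2)"
        using Cauchy_Schwarz_ineq_sum[of "\<lambda>_. 1" T ?J] by simp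
      also have "\<dots> \<le> real M * (168 * real n ^ 4 * real K * real M * (real (card B1))\<^sup>2)"
        by (intro mult_left_mono sumT2) simp
      also have "\<dots> \<le> real M * (real K / (4 * (real n)\<^sup>2) * real K * real M * (real (card B1))\<^sup>2)"
      proof (intro mult_left_mono mult_right_mono)
        \<comment> \<open>This is \<open>672 * n ^ 6 \<le> K\<close> and decides how large
          \<open>K\<close> has to be: the deviation must stay below half the expected count.\<close>
        show "168 * real n ^ 4 \<le> real K / (4 * (real n)\<^sup>2)"
          using \<open>n \<ge> 1\<close> by (simp add: K field_simps flip: power_add)
      qed auto
      also have "\<dots> = (real K * real M * real (card B1) / (2 * real n))\<^sup>2"
        by (simp add: power2_eq_square)
      finally show ?thesis .
    qed
  qed simp
  then have T: "- (real K * real M * real (card B1) / (2 * real n)) \<le> (\<Sum>z\<in>?J. T z)" by linarith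

  have T_count: "T z = (\<Sum>i\<in>?I. real (card {x \<in> B1. x + (z + node Y i)\<^sup>2 \<in> B})) - real K * real (card B1) * ?\<beta>"
    if z: "z \<in> ?J" for z
  proof -
    have "T z = (\<Sum>i\<in>?I. \<Sum>x\<in>?X. of_bool (x \<in> B1) * f (x + (z + node Y i)\<^sup>2))"
      unfolding T_def sum_distrib_left by (rule sum.swap)
    also have "\<dots> = (\<Sum>i\<in>?I. \<Sum>x\<in>B1. f (x + (z + node Y i)\<^sup>2))"
    proof (rule sum.cong[OF refl])
      fix i
      have "B1 \<subseteq> ?X" using B B1 by blast
      then show "(\<Sum>x\<in>?X. of_bool (x \<in> B1) * f (x + (z + node Y i)\<^sup>2)) = (\<Sum>x\<in>B1. f (x + (z + node Y i)\<^sup>2))"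
        by (intro sum.mono_neutral_cong_right) auto
    qed
    also have "\<dots> = (\<Sum>i\<in>?I. real (card {x \<in> B1. x + (z + node Y i)\<^sup>2 \<in> B}) - real (card B1) * ?\<beta>)"
    proof (rule sum.cong[OF refl])
      fix i assume i: "i \<in> ?I"
      have "f (x + (z + node Y i)\<^sup>2) = of_bool (x + (z + node Y i)\<^sup>2 \<in> B) - ?\<beta>" if x: "x \<in> B1" for x
      proof -
        have "(z + node Y i)\<^sup>2 \<le> int \<Delta>"
          unfolding \<Delta>_def of_nat_power using node[OF i] z by (intro power_mono) auto
        then have "0 \<le> x + (z + node Y i)\<^sup>2" "x + (z + node Y i)\<^sup>2 < int L"
          using x B by (auto simp: B1_def)
        then show ?thesis by (simp add: f_def balanced_def)
      qed
      then show "(\<Sum>x\<in>B1. f (x + (z + node Y i)\<^sup>2)) = real (card {x \<in> B1. x + (z + node Y i)\<^sup>2 \<in> B}) - real (card B1) * ?\<beta>"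
        using B1(2) by (simp add: sum_subtractf Int_def)
    qed
    finally show ?thesis by (simp add: sum_subtractf)
  qed
  have "(\<Sum>z\<in>?J. T z) = (\<Sum>z\<in>?J. \<Sum>i\<in>?I. real (card {x \<in> B1. x + (z + node Y i)\<^sup>2 \<in> B}))
      - real M * (real K * real (card B1) * ?\<beta>)"
    by (simp add: T_count sum_subtractf)
  \<comment> \<open>A count is zero unless \<open>z + node Y i\<close> lies in \<open>R\<close>, and
    for each \<open>i\<close> this happens for at most \<open>card R\<close> values of
    \<open>z\<close>.\<close>
  also have "(\<Sum>z\<in>?J. \<Sum>i\<in>?I. real (card {x \<in> B1. x + (z + node Y i)\<^sup>2 \<in> B}))
      \<le> (\<Sum>z\<in>?J. \<Sum>i\<in>?I. real (card B1) * of_bool (z + node Y i \<in> R))"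
  proof (intro sum_mono)
    fix z i assume zi: "z \<in> ?J" "i \<in> ?I"
    show "real (card {x \<in> B1. x + (z + node Y i)\<^sup>2 \<in> B}) \<le> real (card B1) * of_bool (z + node Y i \<in> R)"
    proof (cases "z + node Y i \<in> R")
      case True
      then show ?thesis using B1(2) by (auto intro: card_mono)
    next
      case False
      then have none: "{x \<in> B1. x + (z + node Y i)\<^sup>2 \<in> B} = {}"
        using node[OF zi(2)] zi(1) B1(1) by (auto simp: R_def)
      show ?thesis unfolding none by simp
    qed
  qed
  also have "\<dots> = (\<Sum>i\<in>?I. real (card B1) * real (card {z \<in> ?J. z + node Y i \<in> R}))"
    by (subst sum.swap) (simp add: sum_distrib_left[symmetric] Int_def)
  also have "\<dots> \<le> (\<Sum>i\<in>?I. real (card B1) * real (card R))"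
  proof (intro sum_mono mult_left_mono of_nat_mono)
    fix i
    have "(\<lambda>z. z + node Y i) ` {z \<in> ?J. z + node Y i \<in> R} \<subseteq> R" by auto
    then show "card {z \<in> ?J. z + node Y i \<in> R} \<le> card R"
      by (intro card_inj_on_le[of "\<lambda>z. z + node Y i"]) (simp_all add: \<open>finite R\<close>)
  qed simp
  also have "\<dots> = real K * (real (card B1) * real (card R))" by simp
  finally have "real M * (real K * real (card B1) * ?\<beta>) - real K * real M * real (card B1) / (2 * real n)
      \<le> real K * (real (card B1) * real (card R))"
    using T by linarith
  moreover have "real M * (real K * real (card B1) * (1 / real n)) \<le> real M * (real K * real (card B1) * ?\<beta>)"
  proof (intro mult_left_mono)
    show "1 / real n \<le> ?\<beta>"
      using of_nat_mono[OF dens, where 'a = real] \<open>n \<ge> 1\<close> \<open>L > 0\<close> by (simp add: field_simps)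
  qed auto
  ultimately have "real M * (real K * real (card B1) * (1 / real n)) - real K * real M * real (card B1) / (2 * real n)
      \<le> real K * (real (card B1) * real (card R))"
    by linarith
  then have "(real K * real (card B1)) * (real M / (2 * real n)) \<le> (real K * real (card B1)) * real (card R)"
    using \<open>n \<ge> 1\<close> by (simp add: field_simps)
  then have "real M / (2 * real n) \<le> real (card R)"
    by (rule mult_left_le_imp_le) (use \<open>K \<ge> 1\<close> \<open>card B1 > 0\<close> in simp)
  then have "real (2 * M) \<le> real (4 * n * card R)"
    using \<open>n \<ge> 1\<close> by (simp add: field_simps)
  then show ?thesis unfolding R_def M_eq of_nat_le_iff .
qed

lemma many_square_differences_or_increment:
  fixes n K L y :: nat
  assumes B: "B \<subseteq> {0..<int L}" and "n \<ge> 1" and K: "K = 784 * n ^ 6" and "y \<ge> 1"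
    and L: "(16 * K ^ 6 * y)\<^sup>2 \<le> L" and dens: "L \<le> n * card B"
  shows "8 * K ^ 5 * y \<le> 4 * n * card {z \<in> {1..int (8 * K ^ 5 * y)}. \<exists>x\<in>B. x + z\<^sup>2 \<in> B} \<or>
    (\<exists>a. \<exists>d\<in>{1..2 * K ^ 3}. (real (card B) / real L + 1 / (2 * real K)) * real (y\<^sup>2)
      \<le> real (card {t \<in> {0..<int (y\<^sup>2)}. a + (int d)\<^sup>2 * t \<in> B}))" (is "?ret \<or> ?inc")
proof (cases "\<forall>g\<in>{1..K ^ 3}. (\<Sum>x\<in>{0..<int L}. \<bar>\<Sum>s\<in>{0..<int (2 * g * y\<^sup>2)}. balanced L B (x + 2 * int g * s)\<bar>)
        \<le> 3 / real K * real L * real (2 * g * y\<^sup>2)")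
  case True
  then have ?ret by (intro many_square_differences[OF assms]) auto
  then show ?thesis ..
next
  case False
  then obtain g where g: "g \<in> {1..K ^ 3}" "3 / real K * real L * real (2 * g * y\<^sup>2)
      < (\<Sum>x\<in>{0..<int L}. \<bar>\<Sum>s\<in>{0..<int (2 * g * y\<^sup>2)}. balanced L B (x + 2 * int g * s)\<bar>)"
    by (auto simp: not_le)
  have "K \<ge> 1" using \<open>n \<ge> 1\<close> K by simp
  moreover have "(16 * K ^ 6 * y)\<^sup>2 > 0" using \<open>K \<ge> 1\<close> \<open>y \<ge> 1\<close> by simp
  with L have "L > 0" by linarith
  ultimately obtain a where "(real (card B) / real L + 1 / (2 * real K)) * real (y\<^sup>2)
    \<le> real (card {t \<in> {0..<int (y\<^sup>2)}. a + (int (2 * g))\<^sup>2 * t \<in> B})"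
    using density_increment[OF B _ _ \<open>y \<ge> 1\<close> g(1) L g(2)] by blast
  moreover have "2 * g \<in> {1..2 * K ^ 3}" using g(1) by auto
  ultimately show ?thesis by blast
qed

text \<open>The density exceeds 1 after \<open>2 K\<close> increments, so \<open>m\<close> counts the increments still possible.\<close>

lemma many_dilated_square_differences:
  fixes n K y :: nat
  assumes n: "n \<ge> 1" and K: "K = 784 * n ^ 6" and y: "y \<ge> 1"
    and "B \<subseteq> {0..<int L}" "((16 * K ^ 6) ^ Suc m * y)\<^sup>2 \<le> L" "L \<le> n * card B"
    and "1 - real m / (2 * real K) \<le> real (card B) / real L"
  shows "\<exists>d\<in>{1..(16 * K ^ 6) ^ m}. \<exists>Z\<ge>y.
    Z \<le> 4 * n * card {z \<in> {1..int Z}. \<exists>x\<in>B. x + (int d * z)\<^sup>2 \<in> B}"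
  using assms(4-)
proof (induction m arbitrary: B L)
  case (0 B L)
  have "K \<ge> 1" using n K by simp
  have "(16 * K ^ 6 * y)\<^sup>2 > 0" using \<open>K \<ge> 1\<close> y by simp
  moreover have "(16 * K ^ 6 * y)\<^sup>2 \<le> L" using 0(2) by simp
  ultimately have "L > 0" by linarith
  have ge1: "real (card B) / real L \<ge> 1" using 0 by simp
  have "\<not> (real (card B) / real L + 1 / (2 * real K)) * real (y\<^sup>2) \<le> real (card {t \<in> {0..<int (y\<^sup>2)}. a + (int d)\<^sup>2 * t \<in> B})" for a d
  proof -
    have "card {t \<in> {0..<int (y\<^sup>2)}. a + (int d)\<^sup>2 * t \<in> B} \<le> card {0..<int (y\<^sup>2)}"
      by (intro card_mono) auto
    then have "real (card {t \<in> {0..<int (y\<^sup>2)}. a + (int d)\<^sup>2 * t \<in> B}) \<le> 1 * real (y\<^sup>2)"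
      by (simp add: nat_power_eq flip: of_nat_power)
    also have "\<dots> < (real (card B) / real L + 1 / (2 * real K)) * real (y\<^sup>2)"
    proof (rule mult_strict_right_mono)
      have "1 / (2 * real K) > 0" using \<open>K \<ge> 1\<close> by simp
      then show "1 < real (card B) / real L + 1 / (2 * real K)" using ge1 by linarith
    qed (use y in simp)
    finally show ?thesis by linarith
  qed
  then have "8 * K ^ 5 * y \<le> 4 * n * card {z \<in> {1..int (8 * K ^ 5 * y)}. \<exists>x\<in>B. x + z\<^sup>2 \<in> B}"
    using many_square_differences_or_increment[OF 0(1) n K y _ 0(3)] 0(2) by auto
  moreover have "y \<le> 8 * K ^ 5 * y" using \<open>K \<ge> 1\<close> by simp
  ultimately show ?case by (intro bexI[of _ 1] exI[of _ "8 * K ^ 5 * y"]) auto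
next
  case (Suc m B L)
  define A where "A = 16 * K ^ 6"
  define y1 where "y1 = A ^ Suc m * y"
  have "K \<ge> 1" using n K by simp
  have "A \<ge> 1" using \<open>K \<ge> 1\<close> by (simp add: A_def)
  have y1: "y1 \<ge> y" "y1 \<ge> 1" using \<open>A \<ge> 1\<close> y by (auto simp: y1_def Suc_le_eq)
  have L: "(16 * K ^ 6 * y1)\<^sup>2 \<le> L"
    using Suc.prems(2) by (simp add: y1_def A_def mult.assoc)
  have "(16 * K ^ 6 * y1)\<^sup>2 > 0" using \<open>K \<ge> 1\<close> y1 by simp
  with L have "L > 0" by linarith
  from many_square_differences_or_increment[OF Suc.prems(1) n K y1(2) L Suc.prems(3)]
  show ?case
  proof
    assume "8 * K ^ 5 * y1 \<le> 4 * n * card {z \<in> {1..int (8 * K ^ 5 * y1)}. \<exists>x\<in>B. x + z\<^sup>2 \<in> B}"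
    moreover have "y1 \<le> 8 * K ^ 5 * y1" using \<open>K \<ge> 1\<close> by simp
    then have "y \<le> 8 * K ^ 5 * y1" using y1 by linarith
    ultimately show ?case
      using \<open>A \<ge> 1\<close> by (intro bexI[of _ 1] exI[of _ "8 * K ^ 5 * y1"]) (auto simp: A_def Suc_le_eq)
  next
    assume "\<exists>a. \<exists>d\<in>{1..2 * K ^ 3}. (real (card B) / real L + 1 / (2 * real K)) * real (y1\<^sup>2)
      \<le> real (card {t \<in> {0..<int (y1\<^sup>2)}. a + (int d)\<^sup>2 * t \<in> B})"
    then obtain a d where d: "d \<in> {1..2 * K ^ 3}"
      and inc: "(real (card B) / real L + 1 / (2 * real K)) * real (y1\<^sup>2)
        \<le> real (card {t \<in> {0..<int (y1\<^sup>2)}. a + (int d)\<^sup>2 * t \<in> B})" by blast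
    define B' where "B' = {t \<in> {0..<int (y1\<^sup>2)}. a + (int d)\<^sup>2 * t \<in> B}"
    have dens: "real (card B) / real L + 1 / (2 * real K) \<le> real (card B') / real (y1\<^sup>2)"
      using inc y1 by (simp add: B'_def field_simps)
    have "d \<le> A"
    proof -
      have "2 * K ^ 3 \<le> A" unfolding A_def using \<open>K \<ge> 1\<close> by (intro mult_mono power_increasing) auto
      then show ?thesis using d by simp
    qed
    have "y1\<^sup>2 \<le> n * card B'"
    proof -
      have "1 / real n \<le> real (card B) / real L"
        using of_nat_mono[OF Suc.prems(3), where 'a = real] n \<open>L > 0\<close> by (simp add: field_simps)
      also have "\<dots> \<le> real (card B') / real (y1\<^sup>2)"
        using dens by (smt (verit) divide_nonneg_nonneg of_nat_0_le_iff)
      finally have "real (y1\<^sup>2) \<le> real (n * card B')" using n y1 by (simp add: field_simps)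
      then show ?thesis by (simp only: of_nat_le_iff)
    qed
    moreover have "1 - real m / (2 * real K) \<le> real (card B') / real (y1\<^sup>2)"
      using dens Suc.prems(4) \<open>K \<ge> 1\<close> by (simp add: add_divide_distrib)
    moreover have "B' \<subseteq> {0..<int (y1\<^sup>2)}" by (auto simp: B'_def)
    moreover have "((16 * K ^ 6) ^ Suc m * y)\<^sup>2 \<le> y1\<^sup>2" by (simp add: y1_def A_def)
    ultimately obtain d' Z where d': "d' \<in> {1..A ^ m}" and Z: "Z \<ge> y"
      "Z \<le> 4 * n * card {z \<in> {1..int Z}. \<exists>x\<in>B'. x + (int d' * z)\<^sup>2 \<in> B'}"
      using Suc.IH[of B' "y1\<^sup>2"] unfolding A_def by blast
    \<comment> \<open>The progression has difference \<open>d ^ 2\<close>, so the square of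
      \<open>d' * z\<close> in the coordinate of \<open>B'\<close> becomes the square of
      \<open>d * d' * z\<close> in that of \<open>B\<close>.\<close>
    have "{z \<in> {1..int Z}. \<exists>x\<in>B'. x + (int d' * z)\<^sup>2 \<in> B'} \<subseteq> {z \<in> {1..int Z}. \<exists>x\<in>B. x + (int (d * d') * z)\<^sup>2 \<in> B}"
    proof safe
      fix z x assume "x \<in> B'" "x + (int d' * z)\<^sup>2 \<in> B'"
      then have "a + (int d)\<^sup>2 * x \<in> B" "(a + (int d)\<^sup>2 * x) + (int (d * d') * z)\<^sup>2 \<in> B"
        by (auto simp: B'_def power_mult_distrib algebra_simps)
      then show "\<exists>x\<in>B. x + (int (d * d') * z)\<^sup>2 \<in> B" by blast
    qed
    moreover have "finite {z \<in> {1..int Z}. \<exists>x\<in>B. x + (int (d * d') * z)\<^sup>2 \<in> B}"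
      by (rule finite_subset[of _ "{1..int Z}"]) auto
    ultimately have "card {z \<in> {1..int Z}. \<exists>x\<in>B'. x + (int d' * z)\<^sup>2 \<in> B'}
        \<le> card {z \<in> {1..int Z}. \<exists>x\<in>B. x + (int (d * d') * z)\<^sup>2 \<in> B}"
      by (intro card_mono)
    then have "Z \<le> 4 * n * card {z \<in> {1..int Z}. \<exists>x\<in>B. x + (int (d * d') * z)\<^sup>2 \<in> B}"
      using Z(2) mult_le_mono2 order_trans by blast
    moreover have "d * d' \<in> {1..A ^ Suc m}"
      using d d' \<open>d \<le> A\<close> by (auto intro: mult_mono simp: Suc_le_eq)
    ultimately show ?case using Z(1) unfolding A_def by blast
  qed
qed

section \<open>The quantitative Sarkozy theorem\<close>

text \<open>With \<open>K = 784 * n ^ 6\<close> this is \<open>(16 * K ^ 6) ^ (2 * K + 1)\<close>: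
  one factor for each possible increment and one for the final count. It bounds both the dilation
  \<open>d\<close> and the loss in the square root of the length.\<close>

definition sarkozy_bound :: "nat \<Rightarrow> nat" where
  "sarkozy_bound n = (16 * (784 * n ^ 6) ^ 6) ^ Suc (2 * (784 * n ^ 6))"

lemma sarkozy_bound_ge:
  assumes "n \<ge> 1"
  shows "sarkozy_bound n \<ge> 1"
  using assms by (simp add: sarkozy_bound_def Suc_le_eq)

lemma sarkozy_bound_mono:
  assumes "1 \<le> m" "m \<le> n"
  shows "sarkozy_bound m \<le> sarkozy_bound n"
proof -
  have "16 * (784 * m ^ 6) ^ 6 \<ge> 1" using assms by (simp add: Suc_le_eq)
  then have "sarkozy_bound m \<le> (16 * (784 * m ^ 6) ^ 6) ^ Suc (2 * (784 * n ^ 6))"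
    unfolding sarkozy_bound_def using assms by (intro power_increasing) (auto intro: power_mono)
  also have "\<dots> \<le> sarkozy_bound n"
    unfolding sarkozy_bound_def using assms by (intro power_mono mult_left_mono) auto
  finally show ?thesis .
qed

lemma quantitative_sarkozy:
  assumes "n \<ge> 1" "y \<ge> 1" "B \<subseteq> {0..<int L}" "(sarkozy_bound n * y)\<^sup>2 \<le> L" "L \<le> n * card B"
  shows "\<exists>d\<in>{1..sarkozy_bound n}. \<exists>Z\<ge>y.
    Z \<le> 4 * n * card {z \<in> {1..int Z}. \<exists>x\<in>B. x + (int d * z)\<^sup>2 \<in> B}"
proof -
  define K where "K = 784 * n ^ 6"
  have "K \<ge> 1" using assms by (simp add: K_def)
  \<comment> \<open>For \<open>m = 2 * K\<close> the density demanded at the start is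
    \<open>1 - m / (2 * K) = 0\<close>.\<close>
  then have *: "\<exists>d\<in>{1..(16 * K ^ 6) ^ (2 * K)}. \<exists>Z\<ge>y.
    Z \<le> 4 * n * card {z \<in> {1..int Z}. \<exists>x\<in>B. x + (int d * z)\<^sup>2 \<in> B}"
    using assms by (intro many_dilated_square_differences[OF assms(1) K_def assms(2,3)])
      (auto simp: sarkozy_bound_def K_def)
  have "(16 * K ^ 6) ^ (2 * K) \<le> sarkozy_bound n"
    unfolding sarkozy_bound_def K_def[symmetric] using \<open>K \<ge> 1\<close> by (intro power_increasing) auto
  with * show ?thesis by fastforce
qed

section \<open>Making the colours active one by one\<close>

text \<open>Double counting over starting points \<open>(a, e)\<close>: for each \<open>b\<close>
  the pairs in the box \<open>X\<close> that work correspond to all of \<open>B \<times> E\<close>.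
  The box reaches far enough to the left to contain them, and \<open>p * L' \<le> L\<close>,
  \<open>r * L' \<le> Z\<close> keep its size at most \<open>4 * L * Z\<close>.\<close>

lemma exists_dense_common_progression:
  fixes B E :: "int set" and p r L L' Z :: nat
  assumes B: "B \<subseteq> {0..<int L}" and E: "E \<subseteq> {1..int Z}" and p: "p * L' \<le> L" and r: "r * L' \<le> Z"
    and "L > 0" "Z > 0"
  shows "\<exists>a e. L' * (card B * card E) \<le> 4 * L * Z * card {b \<in> {0..<int L'}. a + int p * b \<in> B \<and> e + int r * b \<in> E}"
proof (rule ccontr)
  define X where "X = {- int (p * L')..<int L} \<times> {1 - int (r * L')..int Z}"
  let ?c = "\<lambda>a e. card {b \<in> {0..<int L'}. a + int p * b \<in> B \<and> e + int r * b \<in> E}"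
  assume "\<not> ?thesis"
  then have less: "4 * L * Z * ?c a e < L' * (card B * card E)" for a e by (auto simp: not_le)
  have cardX: "card X \<le> 4 * L * Z"
  proof -
    have "card X = (L + p * L') * (Z + r * L')"
      unfolding X_def card_cartesian_product by (simp add: nat_add_distrib nat_mult_distrib)
    also have "\<dots> \<le> (L + L) * (Z + Z)" by (intro mult_mono add_mono p r) auto
    finally show ?thesis by (simp add: algebra_simps)
  qed
  have "(0, 1) \<in> X"
    using \<open>L > 0\<close> \<open>Z > 0\<close> by (simp add: X_def flip: of_nat_mult)
  then have "X \<noteq> {}" by blast
  have "finite X" by (simp add: X_def)
  have "(\<Sum>(a, e)\<in>X. ?c a e) = (\<Sum>(a, e)\<in>X. \<Sum>b\<in>{0..<int L'}. of_bool (a + int p * b \<in> B \<and> e + int r * b \<in> E))"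
    by (simp add: Int_def)
  also have "\<dots> = (\<Sum>b\<in>{0..<int L'}. \<Sum>(a, e)\<in>X. of_bool (a + int p * b \<in> B \<and> e + int r * b \<in> E))"
    unfolding case_prod_beta by (rule sum.swap)
  also have "\<dots> = (\<Sum>b\<in>{0..<int L'}. card B * card E)"
  proof (rule sum.cong[OF refl])
    fix b assume b: "b \<in> {0..<int L'}"
    have bounds: "0 \<le> int p * b" "int p * b \<le> int (p * L')" "0 \<le> int r * b" "int r * b \<le> int (r * L')"
      using b by (auto intro: mult_left_mono)
    have "(\<Sum>(a, e)\<in>X. of_bool (a + int p * b \<in> B \<and> e + int r * b \<in> E))
        = card (X \<inter> {ae. fst ae + int p * b \<in> B \<and> snd ae + int r * b \<in> E})"
      unfolding case_prod_beta using \<open>finite X\<close> by simp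
    also have "\<dots> = card (B \<times> E)"
    proof (rule bij_betw_same_card[OF bij_betwI[where f = "\<lambda>(a, e). (a + int p * b, e + int r * b)"
          and g = "\<lambda>(a, e). (a - int p * b, e - int r * b)"]], goal_cases)
      case 2
      show ?case using B E bounds by (force simp: X_def)
    qed auto
    finally show "(\<Sum>(a, e)\<in>X. of_bool (a + int p * b \<in> B \<and> e + int r * b \<in> E)) = card B * card E"
      by (simp add: card_cartesian_product)
  qed
  also have "\<dots> = L' * (card B * card E)" by simp
  finally have total: "(\<Sum>(a, e)\<in>X. ?c a e) = L' * (card B * card E)" .
  have "card X * (L' * (card B * card E)) \<le> 4 * L * Z * (\<Sum>(a, e)\<in>X. ?c a e)"
    unfolding total by (rule mult_right_mono[OF cardX]) simp
  also have "\<dots> = (\<Sum>(a, e)\<in>X. 4 * L * Z * ?c a e)"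
    by (simp add: sum_distrib_left case_prod_beta)
  also have "\<dots> < (\<Sum>(a, e)\<in>X. L' * (card B * card E))"
    unfolding case_prod_beta using \<open>X \<noteq> {}\<close> \<open>finite X\<close> less by (intro sum_strict_mono) auto
  also have "\<dots> = card X * (L' * (card B * card E))" by (simp add: case_prod_beta)
  finally show False by simp
qed

lemma pigeonhole_dense_class:
  assumes "finite Q" "card Q \<le> k" "E = (\<Union>C\<in>Q. F C)" "\<And>C. C \<in> Q \<Longrightarrow> finite (F C)" "Q \<noteq> {}"
  shows "\<exists>C\<in>Q. card E \<le> k * card (F C)"
proof (rule ccontr)
  assume "\<not> ?thesis"
  then have less: "k * card (F C) < card E" if "C \<in> Q" for C using that by auto
  have "k * card E \<le> k * (\<Sum>C\<in>Q. card (F C))"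
    unfolding assms(3) by (intro mult_left_mono card_UN_le assms) simp
  also have "\<dots> < (\<Sum>C\<in>Q. card E)"
    unfolding sum_distrib_left using assms less by (intro sum_strict_mono) auto
  also have "\<dots> \<le> k * card E" using assms(2) by simp
  finally show False by simp
qed

text \<open>Since \<open>t \<le> t ^ 2 \<le> N\<close>, the root has a colour, but in
  \<open>A\<close> it would complete a monochromatic solution.\<close>

lemma uncoloured_square_root:
  assumes part: "partition_on {1..N} P" and nomono: "\<not> has_mono_solution P"
    and "A \<in> P" "t \<ge> 1" and xy: "x \<in> int ` A" "x + t\<^sup>2 \<in> int ` A"
  shows "nat t \<in> {1..N}" "nat t \<notin> A"
proof -
  obtain u v where uv: "u \<in> A" "v \<in> A" "x = int u" "x + t\<^sup>2 = int v" using xy by blast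
  have "u \<ge> 1" "v \<le> N" using uv \<open>A \<in> P\<close> partition_onD1[OF part] by auto
  have "t \<le> t\<^sup>2" using \<open>t \<ge> 1\<close> by (simp add: power2_eq_square mult_le_cancel_left1)
  also have "t\<^sup>2 \<le> int N" using uv \<open>u \<ge> 1\<close> \<open>v \<le> N\<close> by linarith
  finally show "nat t \<in> {1..N}" using \<open>t \<ge> 1\<close> by auto
  show "nat t \<notin> A"
  proof
    assume "nat t \<in> A"
    moreover have "int v - int u = (int (nat t))\<^sup>2" using uv \<open>t \<ge> 1\<close> by simp
    ultimately show False using nomono \<open>A \<in> P\<close> uv unfolding has_mono_solution_def by blast
  qed
qed

text \<open>\<open>I\<close> holds the active colours, all containing a translate of
  \<open>q ^ 2\<close> times \<open>B\<close>. For the many \<open>z\<close> with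
  \<open>(d * z) ^ 2\<close> a difference of \<open>B\<close>, the number \<open>q * d * z\<close>
  avoids every active colour, so some class \<open>C\<close> outside \<open>I\<close> is dense among
  them. A common progression in \<open>B\<close> and in the set of these \<open>z\<close> yields
  \<open>B'\<close>, with \<open>q' = q * d\<close>.\<close>

lemma add_colour:
  fixes D k N r q n L :: nat
  assumes part: "partition_on {1..N} P" and "finite P" and nomono: "\<not> has_mono_solution P"
    and k: "card P \<le> k"
    and D: "\<forall>n\<in>{1..(16 * k) ^ (2 ^ k)}. sarkozy_bound n \<le> D"
    and I: "I \<subseteq> P" "I \<noteq> {}"
    and q: "1 \<le> q" "q \<le> D ^ card I" and n: "1 \<le> n" "n \<le> (16 * k) ^ (2 ^ card I - 1)"
    and B: "B \<subseteq> {0..<int L}" and dens: "L \<le> n * card B"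
    and prog: "\<forall>A\<in>I. \<exists>a. \<forall>b\<in>B. a + (int q)\<^sup>2 * b \<in> int ` A"
    and big: "D ^ ((k + 2) * 4 ^ Suc r) \<le> L" and L': "L' = D ^ ((k + 2) * 4 ^ r)"
  shows "\<exists>C\<in>P - I. \<exists>q' n' B'. 1 \<le> q' \<and> q' \<le> D ^ Suc (card I) \<and>
    1 \<le> n' \<and> n' \<le> (16 * k) ^ (2 ^ Suc (card I) - 1) \<and>
    B' \<subseteq> {0..<int L'} \<and> L' \<le> n' * card B' \<and>
    (\<forall>A\<in>insert C I. \<exists>a. \<forall>b\<in>B'. a + (int q')\<^sup>2 * b \<in> int ` A)"
proof -
  have cardI: "card I \<le> card P" "card I \<ge> 1"
    using I \<open>finite P\<close> by (auto intro: card_mono simp: Suc_le_eq card_gt_0_iff finite_subset)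
  with k have "k \<ge> 1" by linarith
  have "sarkozy_bound 1 \<le> D" using \<open>k \<ge> 1\<close> by (intro bspec[OF D]) (auto simp: Suc_le_eq)
  then have "D \<ge> 1" using sarkozy_bound_ge[of 1] by linarith
  have "2 ^ card I - 1 \<le> (2 ^ k :: nat)"
    using power_increasing[of "card I" k "2 :: nat"] cardI k by linarith
  then have "n \<le> (16 * k) ^ (2 ^ k)"
    using n(2) power_increasing[of "2 ^ card I - 1" "2 ^ k" "16 * k"] \<open>k \<ge> 1\<close> by linarith
  then have S: "sarkozy_bound n \<le> D" using n(1) by (intro bspec[OF D]) simp
  have "L' \<ge> 1" using \<open>D \<ge> 1\<close> by (simp add: L' Suc_le_eq)
  \<comment> \<open>Any \<open>Z \<ge> y\<close> then leaves room for a progression of difference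
    \<open>q * d\<close> and length \<open>L'\<close>. As \<open>q \<le> D ^ k\<close>, the product
    \<open>D * y\<close> is at most \<open>D ^ (k + 2) * L'\<close>; its square fits into
    \<open>L\<close>, whose exponent is four times that of \<open>L'\<close>.\<close>
  define y where "y = q * D * L'"
  have "y \<ge> 1" using q(1) \<open>D \<ge> 1\<close> \<open>L' \<ge> 1\<close> by (simp add: y_def Suc_le_eq)
  have Dy: "(D * y)\<^sup>2 \<le> L"
  proof -
    have "D * y \<le> D * (D ^ k * D * L')"
      unfolding y_def using q(2) power_increasing[of "card I" k D] cardI k \<open>D \<ge> 1\<close>
      by (intro mult_left_mono mult_right_mono) auto
    also have "\<dots> = D ^ ((k + 2) + (k + 2) * 4 ^ r)"
      by (simp add: L' power_add power2_eq_square)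
    finally have "(D * y)\<^sup>2 \<le> (D ^ ((k + 2) + (k + 2) * 4 ^ r))\<^sup>2" by (intro power_mono) auto
    also have "\<dots> = D ^ (((k + 2) + (k + 2) * 4 ^ r) * 2)" by (rule power_mult[symmetric])
    also have "\<dots> \<le> D ^ ((k + 2) * 4 ^ Suc r)"
    proof (rule power_increasing)
      have "(k + 2) * 1 \<le> (k + 2) * 4 ^ r" by (intro mult_left_mono) auto
      then show "((k + 2) + (k + 2) * 4 ^ r) * 2 \<le> (k + 2) * 4 ^ Suc r" by simp
    qed (use \<open>D \<ge> 1\<close> in simp)
    finally show ?thesis using big by linarith
  qed
  have "(D * y)\<^sup>2 > 0" using \<open>D \<ge> 1\<close> \<open>y \<ge> 1\<close> by simp
  with Dy have "L > 0" by linarith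
  have "(sarkozy_bound n * y)\<^sup>2 \<le> L"
    using Dy S by (meson le_trans mult_le_mono1 power_mono zero_le)
  from quantitative_sarkozy[OF n(1) \<open>y \<ge> 1\<close> B this dens]
  obtain d Z where "d \<in> {1..sarkozy_bound n}" and Z: "Z \<ge> y"
    and Z_le: "Z \<le> 4 * n * card {z \<in> {1..int Z}. \<exists>x\<in>B. x + (int d * z)\<^sup>2 \<in> B}" by blast
  with S have d: "1 \<le> d" "d \<le> D" by auto
  define E where "E = {z \<in> {1..int Z}. \<exists>x\<in>B. x + (int d * z)\<^sup>2 \<in> B}"
  define F where "F C = {z \<in> E. nat (int (q * d) * z) \<in> C}" for C
  have "finite E" unfolding E_def by (rule finite_subset[of _ "{1..int Z}"]) auto
  have "Z \<le> 4 * n * card E" using Z_le by (simp add: E_def)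
  have "Z > 0" using Z \<open>y \<ge> 1\<close> by linarith
  with \<open>Z \<le> 4 * n * card E\<close> have "E \<noteq> {}" by auto
  have root: "nat (int (q * d) * z) \<in> {1..N}" "nat (int (q * d) * z) \<notin> A" if z: "z \<in> E" and "A \<in> I" for z A
  proof -
    obtain x where x: "x \<in> B" "x + (int d * z)\<^sup>2 \<in> B" using z by (auto simp: E_def)
    obtain a where a: "\<forall>b\<in>B. a + (int q)\<^sup>2 * b \<in> int ` A" using prog \<open>A \<in> I\<close> by blast
    have eq: "(a + (int q)\<^sup>2 * x) + (int (q * d) * z)\<^sup>2 = a + (int q)\<^sup>2 * (x + (int d * z)\<^sup>2)"
      by (simp add: power_mult_distrib algebra_simps)
    have "a + (int q)\<^sup>2 * x \<in> int ` A" "(a + (int q)\<^sup>2 * x) + (int (q * d) * z)\<^sup>2 \<in> int ` A"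
      unfolding eq using a x by blast+
    moreover have "int (q * d) * z \<ge> 1"
    proof -
      have "int (q * d) > 0" "z > 0" using q(1) d(1) z by (auto simp: E_def)
      then have "int (q * d) * z > 0" by (rule mult_pos_pos)
      then show ?thesis by linarith
    qed
    moreover have "A \<in> P" using \<open>A \<in> I\<close> I by blast
    ultimately show "nat (int (q * d) * z) \<in> {1..N}" "nat (int (q * d) * z) \<notin> A"
      using uncoloured_square_root[OF part nomono] by blast+
  qed
  obtain A0 where "A0 \<in> I" using I by blast
  have E_eq: "E = (\<Union>C\<in>P - I. F C)"
  proof
    show "E \<subseteq> (\<Union>C\<in>P - I. F C)"
    proof
      fix z assume z: "z \<in> E"
      then obtain C where "C \<in> P" "nat (int (q * d) * z) \<in> C"
        using root(1)[OF z \<open>A0 \<in> I\<close>] partition_onD1[OF part] by blast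
      then show "z \<in> (\<Union>C\<in>P - I. F C)" using z root(2)[OF z] by (auto simp: F_def)
    qed
  qed (auto simp: F_def)
  then have "P - I \<noteq> {}" using \<open>E \<noteq> {}\<close> by auto
  moreover have "card (P - I) \<le> k" using card_mono[OF \<open>finite P\<close>, of "P - I"] k by auto
  ultimately obtain C where C: "C \<in> P - I" "card E \<le> k * card (F C)"
    using pigeonhole_dense_class[OF _ _ E_eq] \<open>finite P\<close> \<open>finite E\<close> by (auto simp: F_def)
  have "card (F C) > 0"
    using C(2) \<open>E \<noteq> {}\<close> \<open>finite E\<close> by (auto intro: gr0I)
  have "card B > 0" using dens \<open>L > 0\<close> by (auto intro: gr0I)
  have "d\<^sup>2 * L' \<le> L"
  proof -
    have "d\<^sup>2 * L' \<le> D\<^sup>2 * L'\<^sup>2"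
      using d \<open>L' \<ge> 1\<close> by (intro mult_mono power_mono) (auto simp: power2_eq_square)
    also have "\<dots> \<le> (D * y)\<^sup>2"
    proof -
      have "1 * L' \<le> (q * D) * L'" using q(1) \<open>D \<ge> 1\<close> by (intro mult_right_mono) (auto simp: Suc_le_eq)
      then show ?thesis
        unfolding power_mult_distrib[symmetric] y_def by (intro power_mono mult_left_mono) auto
    qed
    finally show ?thesis using Dy by linarith
  qed
  moreover have "q * d * L' \<le> Z"
  proof -
    have "q * d * L' \<le> q * D * L'" using d(2) by (rule mult_le_mono[OF mult_le_mono[OF order_refl] order_refl])
    also have "\<dots> \<le> Z" using Z by (simp add: y_def)
    finally show ?thesis .
  qed
  moreover have "F C \<subseteq> {1..int Z}" by (auto simp: F_def E_def)
  ultimately obtain a e where ae: "L' * (card B * card (F C)) \<le> 4 * L * Z *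
      card {b \<in> {0..<int L'}. a + int (d\<^sup>2) * b \<in> B \<and> e + int (q * d) * b \<in> F C}"
    using exists_dense_common_progression[OF B] \<open>L > 0\<close> \<open>Z > 0\<close> by blast
  define B' where "B' = {b \<in> {0..<int L'}. a + int (d\<^sup>2) * b \<in> B \<and> e + int (q * d) * b \<in> F C}"
  \<comment> \<open>The factors are 4 from the double counting, \<open>n\<close> from the density of
    \<open>B\<close>, \<open>4 * n\<close> from that of \<open>E\<close>, and \<open>k\<close> from
    the pigeonhole.\<close>
  define n' where "n' = 16 * k * n\<^sup>2"
  have "L' \<le> n' * card B'"
  proof -
    have "Z \<le> 4 * n * (k * card (F C))"
      using \<open>Z \<le> 4 * n * card E\<close> C(2) by (meson le_trans mult_le_mono2)
    then have "4 * L * Z * card B' \<le> 4 * (n * card B) * (4 * n * (k * card (F C))) * card B'"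
      by (intro mult_mono dens) auto
    also have "\<dots> = (n' * card B') * (card B * card (F C))"
      by (simp add: n'_def power2_eq_square)
    finally have "L' * (card B * card (F C)) \<le> (n' * card B') * (card B * card (F C))"
      using ae unfolding B'_def[symmetric] by (rule order_trans[rotated])
    then show ?thesis using \<open>card B > 0\<close> \<open>card (F C) > 0\<close> by (simp only: mult_le_cancel2) auto
  qed
  moreover have "n' \<ge> 1" using \<open>k \<ge> 1\<close> n by (simp add: n'_def Suc_le_eq)
  moreover have "n' \<le> (16 * k) ^ (2 ^ Suc (card I) - 1)"
  proof -
    have "n' \<le> 16 * k * ((16 * k) ^ (2 ^ card I - 1))\<^sup>2"
      unfolding n'_def using n by (intro mult_left_mono power_mono) auto
    also have "\<dots> = (16 * k) ^ Suc ((2 ^ card I - 1) * 2)" by (simp only: power_Suc power_mult)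
    \<comment> \<open>Squaring and multiplying by \<open>16 * k\<close> sends the exponent
      \<open>e\<close> to \<open>2 * e + 1\<close>, hence the form
      \<open>2 ^ card I - 1\<close>.\<close>
    also have "Suc ((2 ^ card I - 1) * 2) = 2 ^ Suc (card I) - 1"
    proof -
      have "(1 :: nat) \<le> 2 ^ card I" by simp
      then show ?thesis unfolding power_Suc by linarith
    qed
    finally show ?thesis .
  qed
  moreover have "1 \<le> q * d" "q * d \<le> D ^ Suc (card I)"
    using q d mult_le_mono[of d D q "D ^ card I"] by (auto simp: Suc_le_eq mult.commute)
  moreover have "B' \<subseteq> {0..<int L'}" by (auto simp: B'_def)
  \<comment> \<open>The two differences were chosen to agree after scaling:
    \<open>q ^ 2 * d ^ 2\<close> for an old colour and \<open>(q * d) * (q * d)\<close> for the new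
    one.\<close>
  moreover have "\<exists>c. \<forall>b\<in>B'. c + (int (q * d))\<^sup>2 * b \<in> int ` A" if A: "A \<in> insert C I" for A
  proof (cases "A \<in> I")
    case True
    then obtain c where c: "\<forall>b\<in>B. c + (int q)\<^sup>2 * b \<in> int ` A" using prog by blast
    have eq: "(c + (int q)\<^sup>2 * a) + (int (q * d))\<^sup>2 * b = c + (int q)\<^sup>2 * (a + int (d\<^sup>2) * b)" for b
      by (simp add: power_mult_distrib algebra_simps)
    have "\<forall>b\<in>B'. (c + (int q)\<^sup>2 * a) + (int (q * d))\<^sup>2 * b \<in> int ` A"
      unfolding eq B'_def using c by blast
    then show ?thesis by blast
  next
    case False
    have "int (q * d) * e + (int (q * d))\<^sup>2 * b \<in> int ` C" if "b \<in> B'" for b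
    proof -
      have *: "int (q * d) * (e + int (q * d) * b) = int (q * d) * e + (int (q * d))\<^sup>2 * b"
        by (simp add: power2_eq_square algebra_simps)
      have "nat (int (q * d) * (e + int (q * d) * b)) \<in> C" "e + int (q * d) * b \<ge> 1"
        using that by (auto simp: B'_def F_def E_def)
      moreover from this(2) have "int (q * d) * (e + int (q * d) * b) \<ge> 0"
        by (intro mult_nonneg_nonneg) auto
      ultimately show ?thesis unfolding * by (metis imageI int_nat_eq)
    qed
    with False A show ?thesis by blast
  qed
  ultimately show ?thesis
    by (intro bexI[OF _ C(1)] exI[of _ "q * d"] exI[of _ n'] exI[of _ B'] conjI ballI)
qed

text \<open>Induction on the number \<open>r\<close> of inactive colours. A longer \<open>B\<close>
  would activate another colour: impossible if \<open>r = 0\<close>, and otherwise it gives a common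
  set of a length that the induction hypothesis excludes. One \<open>D\<close> serves all stages, as
  it dominates the bounds for every density that can arise.\<close>

lemma common_dense_set_length_less:
  fixes D k N :: nat
  assumes part: "partition_on {1..N} P" and "finite P" and nomono: "\<not> has_mono_solution P"
    and k: "card P \<le> k"
    and D: "\<forall>n\<in>{1..(16 * k) ^ (2 ^ k)}. sarkozy_bound n \<le> D"
    and "I \<subseteq> P" "I \<noteq> {}" "card P = card I + r"
    and "1 \<le> q" "q \<le> D ^ card I" "1 \<le> n" "n \<le> (16 * k) ^ (2 ^ card I - 1)"
    and "B \<subseteq> {0..<int L}" "L \<le> n * card B"
    and "\<forall>A\<in>I. \<exists>a. \<forall>b\<in>B. a + (int q)\<^sup>2 * b \<in> int ` A"
  shows "L < D ^ ((k + 2) * 4 ^ Suc r)"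
  using assms(6-)
proof (induction r arbitrary: I q n B L)
  case (0 I q n B L)
  have "I = P" using 0(1,3) \<open>finite P\<close> by (intro card_subset_eq) auto
  show ?case
  proof (rule ccontr)
    assume "\<not> L < D ^ ((k + 2) * 4 ^ Suc 0)"
    then have "D ^ ((k + 2) * 4 ^ Suc 0) \<le> L" by (rule leI)
    from add_colour[OF assms(1-5) 0(1,2,4-) this refl] show False
    proof (rule bexE)
      fix C assume "C \<in> P - I"
      then show False by (simp add: \<open>I = P\<close>)
    qed
  qed
next
  case (Suc r I q n B L)
  show ?case
  proof (rule ccontr)
    assume "\<not> L < D ^ ((k + 2) * 4 ^ Suc (Suc r))"
    then have "D ^ ((k + 2) * 4 ^ Suc (Suc r)) \<le> L" by (rule leI)
    from add_colour[OF assms(1-5) Suc.prems(1,2,4-) this refl]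
    obtain C q' n' B' where C: "C \<in> P - I" and new: "1 \<le> q'" "q' \<le> D ^ Suc (card I)"
      "1 \<le> n'" "n' \<le> (16 * k) ^ (2 ^ Suc (card I) - 1)"
      "B' \<subseteq> {0..<int (D ^ ((k + 2) * 4 ^ Suc r))}" "D ^ ((k + 2) * 4 ^ Suc r) \<le> n' * card B'"
      "\<forall>A\<in>insert C I. \<exists>a. \<forall>b\<in>B'. a + (int q')\<^sup>2 * b \<in> int ` A"
      by (elim bexE exE conjE) (rule that)
    have "finite I" using Suc.prems(1) \<open>finite P\<close> by (rule finite_subset)
    then have cardI: "card (insert C I) = Suc (card I)" using C by simp
    have "D ^ ((k + 2) * 4 ^ Suc r) < D ^ ((k + 2) * 4 ^ Suc r)"
    proof (rule Suc.IH[of "insert C I" q' n' B', unfolded cardI])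
      show "insert C I \<subseteq> P" using C Suc.prems(1) by blast
      show "card P = Suc (card I) + r" using Suc.prems(3) by simp
    qed (rule new insert_not_empty)+
    then show False by simp
  qed
qed

lemma colouring_bound:
  assumes "colouring k {1..N} P" "\<not> has_mono_solution P" "k \<ge> 1"
  shows "N \<le> sarkozy_bound ((16 * k) ^ (2 ^ k)) ^ ((k + 2) * 4 ^ k)"
proof (cases "N = 0")
  case False
  define D where "D = sarkozy_bound ((16 * k) ^ (2 ^ k))"
  have P: "partition_on {1..N} P" "finite P" "card P \<le> k"
    using assms(1) by (auto simp: colouring_def)
  have fin: "finite A" if "A \<in> P" for A
    using that partition_onD1[OF P(1)] by (metis Sup_upper finite_atLeastAtMost finite_subset)
  have "P \<noteq> {}" using partition_onD1[OF P(1)] False by auto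
  moreover have "{1..N} = (\<Union>A\<in>P. A)" using partition_onD1[OF P(1)] by simp
  ultimately obtain A where A: "A \<in> P" "card {1..N} \<le> k * card A"
    using pigeonhole_dense_class[OF P(2,3), of "{1..N}" "\<lambda>A. A"] fin by blast
  \<comment> \<open>The largest colour class starts the process with \<open>q = 1\<close>. It is
    moved by one to lie in \<open>{0..<int N}\<close>, and the translation \<open>a = 1\<close>
    moves it back.\<close>
  define B where "B = (\<lambda>u. int u - 1) ` A"
  have "D \<ge> 1" unfolding D_def by (rule sarkozy_bound_ge) (use assms(3) in simp)
  obtain r where r: "card P = Suc r"
    using \<open>P \<noteq> {}\<close> P(2) by (metis card_eq_0_iff not0_implies_Suc)
  have "N < D ^ ((k + 2) * 4 ^ Suc r)"
  proof (rule common_dense_set_length_less[OF P(1,2) assms(2) P(3), where I = "{A}" and q = 1 and n = k and B = B])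
    show "\<forall>n\<in>{1..(16 * k) ^ (2 ^ k)}. sarkozy_bound n \<le> D"
      unfolding D_def by (auto intro: sarkozy_bound_mono)
    have "A \<subseteq> {1..N}" using A(1) partition_onD1[OF P(1)] by blast
    then show "B \<subseteq> {0..<int N}" by (force simp: B_def)
    have "card B = card A" unfolding B_def by (intro card_image inj_onI) auto
    then show "N \<le> k * card B" using A(2) by simp
    show "\<forall>A'\<in>{A}. \<exists>a. \<forall>b\<in>B. a + (int 1)\<^sup>2 * b \<in> int ` A'"
      by (auto simp: B_def intro: exI[of _ 1])
  qed (use A(1) r \<open>D \<ge> 1\<close> assms(3) in auto)
  also have "\<dots> \<le> D ^ ((k + 2) * 4 ^ k)"
    using r P(3) \<open>D \<ge> 1\<close> by (intro power_increasing mult_left_mono) auto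
  finally show ?thesis by (simp add: D_def)
qed simp

section \<open>Numerical estimates and the triple exponential\<close>

lemma sarkozy_bound_le:
  assumes n: "1 \<le> n" "n \<le> 2 ^ X" and X: "16 \<le> X"
  shows "sarkozy_bound n \<le> 2 ^ (43 * X * 2 ^ (8 * X))"
proof -
  have K: "784 * n ^ 6 \<le> 2 ^ (7 * X)"
  proof -
    have "784 * n ^ 6 \<le> 2 ^ 10 * (2 ^ X) ^ 6" using n by (intro mult_mono power_mono) auto
    also have "\<dots> = 2 ^ (10 + X * 6)" unfolding power_add power_mult ..
    also have "\<dots> \<le> 2 ^ (7 * X)" using X by (intro power_increasing) auto
    finally show ?thesis .
  qed
  have "16 * (784 * n ^ 6) ^ 6 \<le> 2 ^ 4 * (2 ^ (7 * X)) ^ 6"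
    by (intro mult_mono power_mono K) auto
  also have "\<dots> = 2 ^ (4 + (7 * X) * 6)" unfolding power_add power_mult ..
  also have "\<dots> \<le> 2 ^ (43 * X)" using X by (intro power_increasing) auto
  finally have "sarkozy_bound n \<le> (2 ^ (43 * X)) ^ Suc (2 * (784 * n ^ 6))"
    unfolding sarkozy_bound_def by (intro power_mono) auto
  also have "\<dots> \<le> (2 ^ (43 * X)) ^ (2 ^ (8 * X))"
  proof (rule power_increasing)
    have "Suc (2 * (784 * n ^ 6)) \<le> 4 * 2 ^ (7 * X)" using K n(1) one_le_power[OF n(1), of 6] by linarith
    also have "\<dots> = 2 ^ (2 + 7 * X)" by (simp add: power_add)
    also have "\<dots> \<le> 2 ^ (8 * X)" using X by (intro power_increasing) auto
    finally show "Suc (2 * (784 * n ^ 6)) \<le> 2 ^ (8 * X)" .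
  qed simp
  finally show ?thesis by (simp add: power_mult)
qed

lemma colouring_bound_tower:
  assumes "k \<ge> 1"
  shows "sarkozy_bound ((16 * k) ^ (2 ^ k)) ^ ((k + 2) * 4 ^ k) \<le> 2 ^ (2 ^ (2 ^ (8 * k)))"
proof -
  \<comment> \<open>\<open>X\<close> is single exponential in \<open>k\<close> and bounds the binary
    logarithm of the inverse density. The Sarkozy bound is double exponential in \<open>X\<close>,
    and the outer power \<open>(k + 2) * 4 ^ k\<close> only adds to the inner exponent.\<close>
  define X :: nat where "X = 2 ^ (4 * k)"
  have four: "(4 :: nat) ^ k = 2 ^ (2 * k)" by (simp add: power_mult)
  have "(2 :: nat) ^ 4 \<le> X" unfolding X_def using assms by (intro power_increasing) auto
  then have X: "16 \<le> X" by simp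
  have self: "m \<le> 2 ^ m" for m :: nat using less_exp[of m] by simp
  have n: "(16 * k) ^ (2 ^ k) \<le> 2 ^ X"
  proof -
    have "16 * k \<le> 2 ^ 4 * 2 ^ k" using self[of k] by simp
    also have "\<dots> = 2 ^ (4 + k)" by (simp only: power_add)
    finally have "(16 * k) ^ (2 ^ k) \<le> (2 ^ (4 + k)) ^ (2 ^ k)" by (intro power_mono) auto
    also have "\<dots> = 2 ^ ((4 + k) * 2 ^ k)" by (simp only: power_mult)
    also have "\<dots> \<le> 2 ^ X"
    proof (rule power_increasing)
      have "4 + k \<le> 4 * 2 ^ k" using self[of k] assms one_le_power[of "2::nat" k] less_exp[of k] by linarith
      also have "\<dots> = 2 ^ (2 + k)" by (simp add: power_add)
      also have "\<dots> \<le> 2 ^ (3 * k)" using assms by (intro power_increasing) auto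
      finally have "(4 + k) * 2 ^ k \<le> 2 ^ (3 * k) * 2 ^ k" by simp
      also have "\<dots> = X" by (simp add: X_def flip: power_add)
      finally show "(4 + k) * 2 ^ k \<le> X" .
    qed simp
    finally show ?thesis .
  qed
  have "1 \<le> (16 * k) ^ (2 ^ k)" using assms by simp
  then have "sarkozy_bound ((16 * k) ^ (2 ^ k)) ^ ((k + 2) * 4 ^ k) \<le> (2 ^ (43 * X * 2 ^ (8 * X))) ^ ((k + 2) * 4 ^ k)"
    by (intro power_mono sarkozy_bound_le n X) auto
  also have "\<dots> = 2 ^ (43 * X * 2 ^ (8 * X) * ((k + 2) * 4 ^ k))" by (simp only: power_mult)
  also have "\<dots> \<le> 2 ^ (2 ^ (11 * X))"
  proof (rule power_increasing)
    have a: "43 * X \<le> 2 ^ X * 2 ^ X"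
    proof (rule mult_mono)
      have "(2 :: nat) ^ 6 \<le> 2 ^ X" using X by (intro power_increasing) auto
      then show "43 \<le> (2 :: nat) ^ X" by simp
    qed (use self[of X] in auto)
    have b: "(k + 2) * 4 ^ k \<le> 2 ^ X"
    proof -
      have "k + 2 \<le> 2 * 2 ^ k" using less_exp[of k] assms by linarith
      also have "\<dots> = 2 ^ (1 + k)" by simp
      also have "\<dots> \<le> 2 ^ (2 * k)" using assms by (intro power_increasing) auto
      finally have "(k + 2) * 4 ^ k \<le> 2 ^ (2 * k) * 2 ^ (2 * k)"
        unfolding four by (rule mult_right_mono) simp
      also have "\<dots> = X" by (simp add: X_def flip: power_add)
      also have "\<dots> \<le> 2 ^ X" by (rule self)
      finally show ?thesis .
    qed
    have "43 * X * 2 ^ (8 * X) * ((k + 2) * 4 ^ k) \<le> 2 ^ X * 2 ^ X * 2 ^ (8 * X) * 2 ^ X"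
      by (rule mult_le_mono[OF mult_le_mono[OF a order_refl] b])
    also have "\<dots> = 2 ^ (11 * X)" by (simp flip: power_add)
    finally show "43 * X * 2 ^ (8 * X) * ((k + 2) * 4 ^ k) \<le> 2 ^ (11 * X)" .
  qed simp
  \<comment> \<open>Here \<open>11 * X \<le> X * X = 2 ^ (8 * k)\<close>, which is the origin of the
    constant 8.\<close>
  also have "\<dots> \<le> 2 ^ (2 ^ (2 ^ (8 * k)))"
  proof (intro power_increasing)
    have "11 * X \<le> X * X" using X by (intro mult_right_mono) auto
    also have "\<dots> = 2 ^ (8 * k)" by (simp add: X_def flip: power_add)
    finally show "11 * X \<le> 2 ^ (8 * k)" .
  qed auto
  finally show ?thesis .
qed

theorem theorem1p1:
  "\<exists>C::real. C > 0 \<and>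
     (\<forall>k N :: nat.
        (\<exists>P. colouring k {1..N} P \<and> \<not> has_mono_solution P) \<longrightarrow>
        real N \<le> 2 powr (2 powr (2 powr (C * real k))))"
proof (intro exI[of _ 8] conjI allI impI)
  fix k N :: nat
  assume "\<exists>P. colouring k {1..N} P \<and> \<not> has_mono_solution P"
  then obtain P where P: "colouring k {1..N} P" "\<not> has_mono_solution P" by blast
  show "real N \<le> 2 powr (2 powr (2 powr (8 * real k)))"
  proof (cases "k = 0")
    case True
    then have "P = {}" using P(1) by (auto simp: colouring_def)
    then have "N = 0" using P(1) by (auto simp: colouring_def partition_on_def)
    then show ?thesis by simp
  next
    case False
    then have "N \<le> 2 ^ (2 ^ (2 ^ (8 * k)))"
      using colouring_bound[OF P] colouring_bound_tower[of k] by simp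
    then have "real N \<le> real (2 ^ (2 ^ (2 ^ (8 * k))))" by (rule of_nat_mono)
    also have "\<dots> = 2 powr (2 powr (2 powr (8 * real k)))"
      by (simp add: powr_realpow flip: powr_realpow)
    finally show ?thesis .
  qed
qed simp

end
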